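(* Let $d\ge 2$ be an integer, $q$ a power of a prime $p$ with $q\equiv 1\pmod d$, $t=\frac{q-1}{d}$, $T$ a generator of $\widehat{\mathbb F_q^{\times}}$, and $\lambda\in\mathbb F_q^\times$. Then \begin{align*} \#X_{\lambda}^d(\mathbb F_q)&=\frac{q^{d-1}-1}{q-1}+q^{d-2}\,{}_{d-1}F_{d-2}\left(\left.\begin{array}{cccc}T^t&T^{2t}&\ldots&T^{(d-1)t}\\ {}&\epsilon&\ldots&\epsilon\end{array}\right|\frac{1}{\lambda^d}\right)_q\\ &\quad+\frac1q\sum_{w\in W^{**}}\prod_{i=1}^d g(T^{w_it})+\frac{1}{q-1}\sum_{[w]\in W/\sim,\ [w]\neq[0]}\ \sum_{j=0}^{q-2}\frac{\prod_{i=1}^d g(T^{w_it+j})}{g(T^{dj})}\,T^{dj}(d\lambda). \end{align*}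
   Context: $X_\lambda^d$ is the Dwork hypersurface in $\mathbb P^{d-1}$ defined by $x_1^d+\cdots+x_d^d=d\lambda x_1x_2\cdots x_d$, and $\#X_\lambda^d(\mathbb F_q)$ its number of $\mathbb F_q$-rational points. $W$ is the set of $d$-tuples $w=(w_1,\dots,w_d)$ of integers with $0\le w_i<d$ and $\sum_i w_i\equiv0\pmod d$; $w\sim w'$ if $w-w'$ is congruent modulo $d$ to a multiple of $(1,\dots,1)$; the inner summand depends only on the class $[w]$, and $[0]$ is the class of $(0,\dots,0)$. $W^{**}\subset W$ is the set of tuples with all $w_i\ne0$ and the $w_i$ not all equal. Characters are extended by $\chi(0)=0$; $\epsilon$ is the trivial character. With $\mathrm{tr}:\mathbb F_q\to\mathbb F_p$ the trace, $\zeta$ a fixed primitive $p$-th root of unity and $\theta(x)=\zeta^{\mathrm{tr}(x)}$, the Gauss sum is $g(\chi)=\sum_{x\in\mathbb F_q}\chi(x)\theta(x)$. For characters $A,B$, $\binom{A}{B}:=\frac{B(-1)}{q}\sum_{x\in\mathbb F_q}A(x)\overline B(1-x)$, and Greene's function is ${}_{n+1}F_n\left(\left.\begin{array}{ccc}A_0&\ldots&A_n\\ &B_1\ldots&B_n\end{array}\right|x\right)_q:=\frac{q}{q-1}\sum_\chi\binom{A_0\chi}{\chi}\prod_{i=1}^n\binom{A_i\chi}{B_i\chi}\chi(x)$, summed over all characters $\chi$. *)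

theory Defs
  imports Complex_Main "HOL-Computational_Algebra.Primes" "HOL-Library.Cardinality" "HOL-Number_Theory.Cong"
begin

(* Multiplicative characters of F_q^x, extended by chi(0) = 0, as functions 'a => complex *)
definition is_mchar :: "('a::field \<Rightarrow> complex) \<Rightarrow> bool" where
  "is_mchar \<chi> \<longleftrightarrow> \<chi> 0 = 0 \<and> \<chi> 1 = 1 \<and>
     (\<forall>x y. x \<noteq> 0 \<longrightarrow> y \<noteq> 0 \<longrightarrow> \<chi> (x * y) = \<chi> x * \<chi> y)"

(* the trivial character epsilon (with epsilon(0) = 0) *)
definition triv_char :: "'a::field \<Rightarrow> complex" where
  "triv_char x = (if x = 0 then 0 else 1)"

(* power T^k of a character *)
definition char_pow :: "('a::field \<Rightarrow> complex) \<Rightarrow> nat \<Rightarrow> 'a \<Rightarrow> complex" where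
  "char_pow T k x = (if x = 0 then 0 else T x ^ k)"

(* T generates the character group *)
definition char_generator :: "('a::field \<Rightarrow> complex) \<Rightarrow> bool" where
  "char_generator T \<longleftrightarrow> is_mchar T \<and>
     (\<forall>\<chi>. is_mchar \<chi> \<longrightarrow> (\<exists>k. \<chi> = char_pow T k))"

(* pointwise product of characters *)
definition char_mult :: "('a \<Rightarrow> complex) \<Rightarrow> ('a \<Rightarrow> complex) \<Rightarrow> 'a \<Rightarrow> complex" where
  "char_mult A B x = A x * B x"

(* absolute trace F_q -> F_p, q = p^n *)
definition ftrace :: "nat \<Rightarrow> nat \<Rightarrow> 'a::field \<Rightarrow> 'a" where
  "ftrace p n x = (\<Sum>k<n. x ^ (p ^ k))"

(* theta(x) = zeta^{tr(x)}, tr(x) identified with an element of {0..<p} *)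
definition add_char :: "nat \<Rightarrow> nat \<Rightarrow> complex \<Rightarrow> 'a::field \<Rightarrow> complex" where
  "add_char p n \<zeta> x = \<zeta> ^ (THE m. m < p \<and> of_nat m = ftrace p n x)"

(* Gauss sum g(chi) *)
definition gauss_sum :: "nat \<Rightarrow> nat \<Rightarrow> complex \<Rightarrow> ('a::{field,finite} \<Rightarrow> complex) \<Rightarrow> complex" where
  "gauss_sum p n \<zeta> \<chi> = (\<Sum>x\<in>UNIV. \<chi> x * add_char p n \<zeta> x)"

(* Greene's binomial (A choose B) *)
definition char_binom :: "('a::{field,finite} \<Rightarrow> complex) \<Rightarrow> ('a \<Rightarrow> complex) \<Rightarrow> complex" where
  "char_binom A B = B (-1) / of_nat CARD('a) * (\<Sum>x\<in>UNIV. A x * cnj (B (1 - x)))"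

(* Greene's hypergeometric function _{n+1}F_n(A_0,...,A_n; B_1,...,B_n | x) *)
definition greeneF :: "nat \<Rightarrow> (nat \<Rightarrow> 'a::{field,finite} \<Rightarrow> complex) \<Rightarrow>
    (nat \<Rightarrow> 'a \<Rightarrow> complex) \<Rightarrow> 'a \<Rightarrow> complex" where
  "greeneF n A B x = of_nat CARD('a) / (of_nat CARD('a) - 1) *
     (\<Sum>\<chi>\<in>{\<chi>. is_mchar \<chi>}. char_binom (char_mult (A 0) \<chi>) \<chi> *
        (\<Prod>i\<in>{1..n}. char_binom (char_mult (A i) \<chi>) (char_mult (B i) \<chi>)) * \<chi> x)"

(* Dwork hypersurface: points of P^{d-1}(F_q), as classes of nonzero vectors
   x = (x_0,...,x_{d-1}) (functions nat => 'a vanishing from index d on) up to scalars *)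
definition dwork_points :: "nat \<Rightarrow> 'a::field \<Rightarrow> (nat \<Rightarrow> 'a) set set" where
  "dwork_points d lam =
     (\<lambda>x. {(\<lambda>i. c * x i) | c. c \<noteq> 0}) `
       {x. (\<forall>i\<ge>d. x i = 0) \<and> (\<exists>i<d. x i \<noteq> 0) \<and>
           (\<Sum>i<d. x i ^ d) = of_nat d * lam * (\<Prod>i<d. x i)}"

(* W: tuples (w_0,...,w_{d-1}), 0 <= w_i < d, sum = 0 mod d (w i = 0 for i >= d) *)
definition Wset :: "nat \<Rightarrow> (nat \<Rightarrow> nat) set" where
  "Wset d = {w. (\<forall>i<d. w i < d) \<and> (\<forall>i\<ge>d. w i = 0) \<and> (\<Sum>i<d. w i) mod d = 0}"

(* W^{**}: all w_i nonzero and not all equal *)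
definition Wss :: "nat \<Rightarrow> (nat \<Rightarrow> nat) set" where
  "Wss d = {w \<in> Wset d. (\<forall>i<d. w i \<noteq> 0) \<and> \<not> (\<forall>i<d. \<forall>j<d. w i = w j)}"

(* w ~ w' iff w - w' is congruent mod d to a multiple of (1,...,1) *)
definition Wrel :: "nat \<Rightarrow> ((nat \<Rightarrow> nat) \<times> (nat \<Rightarrow> nat)) set" where
  "Wrel d = {(w, w'). w \<in> Wset d \<and> w' \<in> Wset d \<and>
     (\<exists>k::int. \<forall>i<d. [int (w i) - int (w' i) = k] (mod int d))}"

end

theory Submission
  imports Defs "HOL-Algebra.Algebraic_Closure_Type" "HOL-Number_Theory.Residues"
begin

hide_const (open) Divisibility.prime Coset.order

text \<open>
  Orthogonality of the additive character \<open>\<theta>\<close> expresses \<open>q\<close> times the number of zeros of the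
  form on \<open>F\<^sub>q\<^sup>d\<close> as a sum of products of \<open>\<theta>(z x\<^sub>i\<^sup>d)\<close> and \<open>\<theta>(- z d \<lambda> x\<^sub>1 \<dots> x\<^sub>d)\<close>. Expanding the last
  factor in multiplicative characters separates the variables and gives a sum of products of Gauss
  sums indexed by \<open>w \<in> W\<close> and \<open>j < t\<close>; replacing \<open>w\<close> by \<open>w + (1, \<dots>, 1)\<close> amounts to replacing \<open>j\<close>
  by \<open>j + t\<close>, so the sum regroups into classes with \<open>j < q - 1\<close>. The class of \<open>0\<close> together with the
  constant tuples in \<open>W\<close> is Greene's function: its binomials are Jacobi sums, and the resulting
  product of the \<open>g(T\<^sup>i\<^sup>t \<chi>)\<close> is evaluated by the Hasse--Davenport product formula.

  The product formula is proved with L-series over polynomials \<open>P\<close> with \<open>P(0) = 1\<close>. The weight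
  \<open>\<chi>(\<Prod> b)\<^sup>n \<theta>(\<Sum> b\<^sup>n)\<close> of the reciprocal roots \<open>b\<close> of \<open>P\<close> has L-series \<open>1 + g(\<chi>) X\<close> when \<open>n = 1\<close>.
  Since the number of \<open>d\<close>-th roots of \<open>y\<close> in the extension of degree \<open>k\<close> is \<open>\<Sum>\<^sub>i T\<^sup>i\<^sup>t(N y)\<close>, comparing
  logarithmic derivatives shows that for \<open>n = d\<close> it is the product of the \<open>1 + g(\<chi> T\<^sup>i\<^sup>t) X\<close> over
  \<open>i < d\<close>. Its coefficient at \<open>X\<^sup>d\<close> can also be computed directly, because \<open>\<Sum> b\<^sup>d\<close> is affine in
  the leading coefficient of \<open>P\<close>.
\<close>

section \<open>Finite fields\<close>

lemma card_field_ge_2: "CARD('a::{field,finite}) \<ge> 2"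
proof -
  have "card {0, 1::'a} \<le> CARD('a)"
    by (rule card_mono) auto
  thus ?thesis by simp
qed

lemma of_nat_card_minus_1_nonzero: "of_nat CARD('a::{field,finite}) - 1 \<noteq> (0::'b::ring_char_0)"
proof -
  have "CARD('a) \<noteq> 1" using card_field_ge_2[where 'a='a] by simp
  thus ?thesis by (simp only: of_nat_eq_1_iff right_minus_eq not_False_eq_True)
qed

lemma field_power_card_minus_1:
  fixes x :: "'a::{field,finite}"
  assumes "x \<noteq> 0"
  shows "x ^ (CARD('a) - 1) = 1"
proof -
  have "(\<Prod>y\<in>UNIV-{0}. x * y) = (\<Prod>y\<in>UNIV-{0::'a}. y)"
    by (rule prod.reindex_bij_witness[of _ "\<lambda>y. y / x" "\<lambda>y. x * y"]) (use assms in auto)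
  hence "x ^ (CARD('a) - 1) * \<Prod>(UNIV-{0::'a}) = 1 * \<Prod>(UNIV-{0})"
    by (simp add: prod.distrib)
  thus ?thesis by (subst (asm) mult_right_cancel) auto
qed

lemma field_power_card: "x ^ CARD('a) = (x :: 'a::{field,finite})"
proof (cases "x = 0")
  case False
  have "x ^ CARD('a) = x * x ^ (CARD('a) - 1)"
    by (simp add: power_eq_if)
  thus ?thesis using field_power_card_minus_1[OF False] by simp
qed simp

lemma of_nat_dvd_card_minus_1_nonzero:
  assumes "d dvd CARD('a::{field,finite}) - 1"
  shows "of_nat d \<noteq> (0 :: 'a)"
proof
  assume "of_nat d = (0 :: 'a)"
  hence "CHAR('a) dvd CARD('a) - 1"
    using assms by (auto simp: of_nat_eq_0_iff_char_dvd)
  hence "CHAR('a) dvd CARD('a) - (CARD('a) - 1)"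
    using CHAR_dvd_CARD[where 'a='a] by (rule dvd_diff_nat[rotated])
  moreover have "CARD('a) - (CARD('a) - 1) = 1"
    using card_field_ge_2[where 'a='a] by simp
  ultimately show False by simp
qed

lemma power_cong_exponent:
  fixes z :: "'a::monoid_mult"
  assumes "z ^ n = 1" "[i = j] (mod n)"
  shows "z ^ i = z ^ j"
proof -
  have "z ^ k = z ^ (k mod n)" for k
  proof -
    have "z ^ (n * (k div n) + k mod n) = z ^ (k mod n)"
      by (simp only: power_add power_mult assms(1) power_one mult_1)
    thus ?thesis by simp
  qed
  thus ?thesis using assms(2) by (metis cong_def)
qed

definition primitive_element :: "'a::field \<Rightarrow> bool" where
  "primitive_element g \<longleftrightarrow> g \<noteq> 0 \<and> (\<forall>x. x \<noteq> 0 \<longrightarrow> (\<exists>j::nat. x = g ^ j))"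

lemma ex_primitive_element: "\<exists>g::'a::{field,finite}. primitive_element g"
proof -
  let ?R = "ring_of_type_algebra :: 'a ring"
  interpret R: field ?R by (rule field_from_type_algebra)
  have finite: "finite (carrier ?R)" by (simp add: ring_of_type_algebra_def)
  have power_eq: "x [^]\<^bsub>?R\<^esub> (j::nat) = x ^ j" for x :: 'a and j
    by (induction j) (simp_all add: ring_of_type_algebra_def)
  have carrier: "carrier (Multiplicative_Group.mult_of ?R) = UNIV - {0}"
    by (simp add: ring_of_type_algebra_def)
  have "\<exists>g\<in>UNIV - {0::'a}. UNIV - {0} = {g ^ i | i::nat. i \<in> UNIV}"
    using R.finite_field_mult_group_has_gen[OF finite] unfolding carrier power_eq .
  thus ?thesis by (auto simp: primitive_element_def set_eq_iff)
qed

lemma primitive_element_power_eq_iff: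
  fixes g :: "'a::{field,finite}"
  assumes "primitive_element g"
  shows "g ^ i = g ^ j \<longleftrightarrow> [i = j] (mod (CARD('a) - 1))"
proof -
  let ?N = "CARD('a) - 1"
  have g_nonzero: "g \<noteq> 0" using assms by (simp add: primitive_element_def)
  have order_pos: "?N > 0" using card_field_ge_2[where 'a='a] by simp
  have power_mod: "g ^ k = g ^ (k mod ?N)" for k
    using field_power_card_minus_1[OF g_nonzero]
    by (rule power_cong_exponent) (simp add: cong_def)
  have "UNIV - {0} \<subseteq> (\<lambda>k. g ^ k) ` {..<?N}"
  proof
    fix x assume "x \<in> UNIV - {0 :: 'a}"
    then obtain k where "x = g ^ k" using assms by (auto simp: primitive_element_def)
    thus "x \<in> (\<lambda>k. g ^ k) ` {..<?N}" using power_mod[of k] order_pos by auto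
  qed
  hence "(\<lambda>k. g ^ k) ` {..<?N} = UNIV - {0}" using g_nonzero by auto
  hence "inj_on (\<lambda>k. g ^ k) {..<?N}"
    by (intro eq_card_imp_inj_on) auto
  hence "g ^ (i mod ?N) = g ^ (j mod ?N) \<longleftrightarrow> i mod ?N = j mod ?N"
    using order_pos by (intro inj_on_eq_iff) auto
  thus ?thesis using power_mod[of i] power_mod[of j] by (simp add: cong_def)
qed

section \<open>Multiplicative characters of a finite field\<close>

lemma mchar_0: "is_mchar \<chi> \<Longrightarrow> \<chi> 0 = 0"
  and mchar_1: "is_mchar \<chi> \<Longrightarrow> \<chi> 1 = 1"
  by (auto simp: is_mchar_def)

lemma mchar_mult: "is_mchar \<chi> \<Longrightarrow> \<chi> (x * y) = \<chi> x * \<chi> y"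
  by (cases "x = 0 \<or> y = 0") (auto simp: is_mchar_def)

lemma mchar_power: "is_mchar \<chi> \<Longrightarrow> \<chi> (x ^ k) = \<chi> x ^ k"
  by (induction k) (simp_all add: mchar_mult mchar_1)

lemma mchar_prod: "is_mchar \<chi> \<Longrightarrow> \<chi> (\<Prod>i\<in>A. f i) = (\<Prod>i\<in>A. \<chi> (f i))"
  by (induction A rule: infinite_finite_induct) (simp_all add: mchar_1 mchar_mult)

lemma mchar_inverse:
  assumes "is_mchar \<chi>"
  shows "\<chi> (inverse x) = inverse (\<chi> x)"
proof (cases "x = 0")
  case False
  hence "\<chi> x * \<chi> (inverse x) = 1"
    by (simp add: mchar_1[OF assms] flip: mchar_mult[OF assms])
  thus ?thesis by (metis inverse_unique)
qed (simp add: mchar_0[OF assms])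

lemma mchar_eq_0_iff: "is_mchar \<chi> \<Longrightarrow> \<chi> x = 0 \<longleftrightarrow> x = 0"
  by (metis mchar_0 mchar_1 mchar_mult mult_zero_left right_inverse zero_neq_one)

lemma mchar_power_card_minus_1:
  fixes \<chi> :: "'a::{field,finite} \<Rightarrow> complex"
  assumes "is_mchar \<chi>" "x \<noteq> 0"
  shows "\<chi> x ^ (CARD('a) - 1) = 1"
  using mchar_power[OF assms(1)] field_power_card_minus_1[OF assms(2)] mchar_1[OF assms(1)]
  by metis

lemma mchar_cnj:
  fixes \<chi> :: "'a::{field,finite} \<Rightarrow> complex"
  assumes "is_mchar \<chi>"
  shows "cnj (\<chi> x) = inverse (\<chi> x)"
proof (cases "x = 0")
  case False
  have "norm (\<chi> x) ^ (CARD('a) - 1) = 1"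
    using mchar_power_card_minus_1[OF assms False] by (metis norm_one norm_power)
  moreover have "CARD('a) - 1 > 0" using card_field_ge_2[where 'a='a] by simp
  ultimately have "norm (\<chi> x) = 1"
    using power_eq_imp_eq_base[of "norm (\<chi> x)" "CARD('a) - 1" 1] by simp
  hence "\<chi> x * cnj (\<chi> x) = 1"
    by (metis complex_norm_square of_real_1 power_one)
  thus ?thesis by (metis inverse_unique)
qed (simp add: mchar_0[OF assms])

lemma mchar_minus_1_square: "is_mchar \<chi> \<Longrightarrow> \<chi> (-1) * \<chi> (-1) = 1"
  by (simp add: mchar_1 flip: mchar_mult)

lemma mchar_uminus: "is_mchar \<chi> \<Longrightarrow> \<chi> (- x) = \<chi> (-1) * \<chi> x"
  by (simp flip: mchar_mult)

abbreviation char_cnj :: "('a \<Rightarrow> complex) \<Rightarrow> 'a \<Rightarrow> complex" where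
  "char_cnj \<chi> \<equiv> (\<lambda>x. cnj (\<chi> x))"

lemma is_mchar_triv [intro, simp]: "is_mchar triv_char"
  by (auto simp: is_mchar_def triv_char_def)

lemma is_mchar_char_mult [intro]: "is_mchar A \<Longrightarrow> is_mchar B \<Longrightarrow> is_mchar (char_mult A B)"
  by (auto simp: is_mchar_def char_mult_def)

lemma is_mchar_char_cnj [intro]: "is_mchar A \<Longrightarrow> is_mchar (char_cnj A)"
  by (auto simp: is_mchar_def)

lemma is_mchar_char_pow [intro]: "is_mchar A \<Longrightarrow> is_mchar (char_pow A k)"
  by (auto simp: is_mchar_def char_pow_def power_mult_distrib)

lemma char_mult_commute: "char_mult A B = char_mult B A"
  by (auto simp: char_mult_def)

lemma char_mult_triv_left: "is_mchar A \<Longrightarrow> char_mult triv_char A = A"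
  by (auto simp: char_mult_def triv_char_def mchar_0 fun_eq_iff)

lemma char_mult_cnj_cancel:
  fixes \<psi> :: "'a::{field,finite} \<Rightarrow> complex"
  assumes "is_mchar A" "is_mchar \<psi>"
  shows "char_mult (char_mult A (char_cnj \<psi>)) \<psi> = A"
proof
  show "char_mult (char_mult A (char_cnj \<psi>)) \<psi> x = A x" for x
    using assms by (cases "x = 0") (auto simp: char_mult_def mchar_cnj mchar_0 mchar_eq_0_iff)
qed

lemma char_cnj_triv [simp]: "char_cnj triv_char = triv_char"
  by (auto simp: triv_char_def)

lemma char_pow_0 [simp]: "char_pow T 0 = triv_char"
  by (auto simp: char_pow_def triv_char_def)

lemma char_pow_triv [simp]: "char_pow triv_char k = triv_char"
  by (auto simp: char_pow_def triv_char_def)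

lemma char_pow_add: "char_pow T (i + j) = char_mult (char_pow T i) (char_pow T j)"
  by (auto simp: char_pow_def char_mult_def power_add)

lemma char_pow_mult: "char_pow T (i * j) = char_pow (char_pow T i) j"
  by (auto simp: char_pow_def power_mult)

lemma char_pow_cnj: "char_pow (char_cnj \<chi>) k = char_cnj (char_pow \<chi> k)"
  by (auto simp: char_pow_def)

lemma sum_mchar:
  fixes \<chi> :: "'a::{field,finite} \<Rightarrow> complex"
  assumes "is_mchar \<chi>"
  shows "(\<Sum>x\<in>UNIV. \<chi> x) = (if \<chi> = triv_char then of_nat CARD('a) - 1 else 0)"
proof (cases "\<chi> = triv_char")
  case True
  have "(\<Sum>x\<in>(UNIV::'a set). triv_char x) = (\<Sum>x\<in>UNIV - {0::'a}. 1::complex)"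
    by (rule sum.mono_neutral_cong_right) (auto simp: triv_char_def)
  also have "\<dots> = of_nat CARD('a) - 1"
    using card_field_ge_2[where 'a='a] by (simp add: of_nat_diff)
  finally show ?thesis using True by simp
next
  case False
  then obtain a where "\<chi> a \<noteq> triv_char a" by (auto simp: fun_eq_iff)
  hence a_nontriv: "a \<noteq> 0" "\<chi> a \<noteq> 1"
    using mchar_0[OF assms] by (auto simp: triv_char_def split: if_splits)
  have "(\<Sum>x\<in>UNIV. \<chi> x) = (\<Sum>x\<in>UNIV. \<chi> (a * x))"
    by (rule sum.reindex_bij_witness[of _ "\<lambda>y. a * y" "\<lambda>y. y / a"]) (use a_nontriv in auto)
  also have "\<dots> = \<chi> a * (\<Sum>x\<in>UNIV. \<chi> x)"
    by (simp add: mchar_mult[OF assms] sum_distrib_left)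
  finally show ?thesis using a_nontriv False by simp
qed

lemma ex_mchar_primitive_element:
  fixes g :: "'a::{field,finite}"
  assumes primitive: "primitive_element g" and root: "w ^ (CARD('a) - 1) = 1"
  shows "\<exists>\<chi>. is_mchar \<chi> \<and> \<chi> g = w"
proof -
  define dlog where "dlog x = (SOME j. x = g ^ j)" for x
  have dlog: "x = g ^ dlog x" if "x \<noteq> 0" for x
  proof -
    have "\<exists>j. x = g ^ j" using primitive that by (simp add: primitive_element_def)
    thus ?thesis unfolding dlog_def by (rule someI_ex)
  qed
  have w_dlog: "w ^ dlog (g ^ j) = w ^ j" for j
  proof -
    have "g \<noteq> 0" using primitive by (simp add: primitive_element_def)
    hence "[dlog (g ^ j) = j] (mod (CARD('a) - 1))"
      unfolding primitive_element_power_eq_iff[OF primitive, symmetric]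
      by (intro dlog[symmetric]) simp
    thus ?thesis using root by (rule power_cong_exponent[rotated])
  qed
  define \<chi> where "\<chi> x = (if x = 0 then 0 else w ^ dlog x)" for x
  have "is_mchar \<chi>"
    unfolding is_mchar_def
  proof (intro conjI allI impI)
    show "\<chi> 1 = 1" using w_dlog[of 0] by (simp add: \<chi>_def)
    fix x y :: 'a assume "x \<noteq> 0" "y \<noteq> 0"
    thus "\<chi> (x * y) = \<chi> x * \<chi> y"
      using w_dlog[of "dlog x + dlog y"] by (simp add: \<chi>_def power_add flip: dlog)
  qed (simp add: \<chi>_def)
  moreover have "\<chi> g = w"
    using w_dlog[of 1] primitive by (simp add: \<chi>_def primitive_element_def)
  ultimately show ?thesis by blast
qed

lemma mchar_separates_1:
  fixes x :: "'a::{field,finite}"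
  assumes "x \<noteq> 0" "x \<noteq> 1"
  shows "\<exists>\<chi>. is_mchar \<chi> \<and> \<chi> x \<noteq> 1"
proof -
  let ?N = "CARD('a) - 1"
  obtain g :: 'a where primitive: "primitive_element g" using ex_primitive_element by blast
  have order_pos: "?N > 0" using card_field_ge_2[where 'a='a] by simp
  obtain j where x_eq: "x = g ^ j" using primitive assms(1) by (auto simp: primitive_element_def)
  define k where "k = j mod ?N"
  have x_eq_mod: "x = g ^ k"
    unfolding x_eq primitive_element_power_eq_iff[OF primitive] by (simp add: k_def cong_def)
  have k_less: "k < ?N" using order_pos unfolding k_def by (rule mod_less_divisor)
  have "k \<noteq> 0" using x_eq_mod assms(2) by (intro notI) simp
  define w where "w = (\<lambda>i. cis (2 * pi * real i / real ?N))"
  have bij_w: "bij_betw w {..<?N} {z. z ^ ?N = 1}"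
    unfolding w_def by (rule bij_betw_roots_unity[OF order_pos])
  have w_power: "w i = w 1 ^ i" for i
    by (simp add: w_def DeMoivre mult_ac)
  have "w 1 ^ ?N = w 0"
    using order_pos by (simp add: w_def DeMoivre)
  then obtain \<chi> where mchar: "is_mchar \<chi>" "\<chi> g = w 1"
    using ex_mchar_primitive_element[OF primitive, of "w 1"] by (auto simp: w_def)
  have "w k \<noteq> w 0"
    using inj_onD[OF bij_betw_imp_inj_on[OF bij_w], of k 0] k_less \<open>k \<noteq> 0\<close> order_pos by auto
  hence "\<chi> x \<noteq> 1"
    using w_power[of k]
    by (simp add: x_eq_mod mchar_power[OF mchar(1)] mchar(2)) (simp add: w_def)
  thus ?thesis using mchar(1) by blast
qed

lemma is_mchar_generator: "char_generator T \<Longrightarrow> is_mchar T"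
  by (simp add: char_generator_def)

lemma is_mchar_char_pow_generator: "char_generator T \<Longrightarrow> is_mchar (char_pow T k)"
  by (intro is_mchar_char_pow is_mchar_generator)

lemma char_generator_eq_1_iff:
  fixes x :: "'a::{field,finite}"
  assumes generator: "char_generator T"
  shows "T x = 1 \<longleftrightarrow> x = 1"
proof
  assume T_eq_1: "T x = 1"
  have "\<chi> x = 1" if "is_mchar \<chi>" for \<chi>
  proof -
    have "\<exists>k. \<chi> = char_pow T k" using generator that by (simp add: char_generator_def)
    then obtain k where "\<chi> = char_pow T k" ..
    thus ?thesis using T_eq_1 mchar_0[OF is_mchar_generator[OF generator]]
      by (auto simp: char_pow_def)
  qed
  moreover have "x \<noteq> 0" using T_eq_1 mchar_0[OF is_mchar_generator[OF generator]] by auto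
  ultimately show "x = 1" using mchar_separates_1 by blast
qed (simp add: mchar_1 is_mchar_generator[OF generator])

lemma char_pow_generator_eq_iff:
  fixes T :: "'a::{field,finite} \<Rightarrow> complex"
  assumes generator: "char_generator T"
  shows "char_pow T i = char_pow T j \<longleftrightarrow> [i = j] (mod (CARD('a) - 1))"
proof -
  obtain g :: 'a where primitive: "primitive_element g" using ex_primitive_element by blast
  have mchar: "is_mchar T" by (rule is_mchar_generator[OF generator])
  have T_inj: "x = y" if "T x = T y" "y \<noteq> 0" for x y
  proof -
    have "T (x / y) = 1"
      using that
      by (simp add: field_class.field_divide_inverse mchar_mult[OF mchar]
          mchar_inverse[OF mchar] mchar_eq_0_iff[OF mchar])
    thus ?thesis using that(2) by (simp add: char_generator_eq_1_iff[OF generator])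
  qed
  have "g ^ i = g ^ j" if "char_pow T i = char_pow T j"
  proof -
    have "g \<noteq> 0" using primitive by (simp add: primitive_element_def)
    hence "T (g ^ i) = T (g ^ j)"
      using fun_cong[OF that, of g] by (simp add: char_pow_def mchar_power[OF mchar])
    thus ?thesis using \<open>g \<noteq> 0\<close> by (intro T_inj) auto
  qed
  moreover have "char_pow T i x = char_pow T j x" if "g ^ i = g ^ j" for x
  proof (cases "x = 0")
    case False
    then obtain k where x_eq: "x = g ^ k" using primitive by (auto simp: primitive_element_def)
    have "x ^ i = x ^ j" unfolding x_eq using that
      by (metis power_mult mult.commute)
    thus ?thesis using False mchar_power[OF mchar] by (metis char_pow_def)
  qed (simp add: char_pow_def)
  ultimately show ?thesis
    unfolding primitive_element_power_eq_iff[OF primitive, symmetric] by blast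
qed

lemma char_pow_generator_eq_triv_iff:
  fixes T :: "'a::{field,finite} \<Rightarrow> complex"
  assumes "char_generator T"
  shows "char_pow T k = triv_char \<longleftrightarrow> (CARD('a) - 1) dvd k"
  using char_pow_generator_eq_iff[OF assms, of k 0] by (simp add: cong_0_iff)

lemma sum_char_pow_generator:
  fixes T :: "'a::{field,finite} \<Rightarrow> complex"
  assumes generator: "char_generator T"
  shows "(\<Sum>j<CARD('a) - 1. char_pow T j x) = (if x = 1 then of_nat CARD('a) - 1 else 0)"
proof -
  have mchar: "is_mchar T" by (rule is_mchar_generator[OF generator])
  consider (zero) "x = 0" | (one) "x = 1" | (nontrivial) "x \<noteq> 0" "x \<noteq> 1" by blast
  thus ?thesis
  proof cases
    case one
    thus ?thesis
      using card_field_ge_2[where 'a='a] by (simp add: char_pow_def of_nat_diff mchar_1[OF mchar])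
  next
    case nontrivial
    thus ?thesis
      using mchar_power_card_minus_1[OF mchar]
      by (simp add: char_pow_def sum_gp_strict char_generator_eq_1_iff[OF generator])
  qed (simp add: char_pow_def)
qed

lemma bij_betw_char_pow_generator:
  fixes T :: "'a::{field,finite} \<Rightarrow> complex"
  assumes generator: "char_generator T"
  shows "bij_betw (char_pow T) {..<CARD('a) - 1} {\<chi>. is_mchar \<chi>}"
proof (rule bij_betw_imageI)
  show "inj_on (char_pow T) {..<CARD('a) - 1}"
    unfolding inj_on_def char_pow_generator_eq_iff[OF generator] by (simp add: cong_def)
  show "char_pow T ` {..<CARD('a) - 1} = {\<chi>. is_mchar \<chi>}"
  proof (intro equalityI subsetI)
    fix \<chi> :: "'a \<Rightarrow> complex" assume "\<chi> \<in> {\<chi>. is_mchar \<chi>}"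
    hence "\<exists>k. \<chi> = char_pow T k" using generator by (simp add: char_generator_def)
    then obtain k where "\<chi> = char_pow T k" ..
    also have "\<dots> = char_pow T (k mod (CARD('a) - 1))"
      by (simp add: char_pow_generator_eq_iff[OF generator])
    finally show "\<chi> \<in> char_pow T ` {..<CARD('a) - 1}"
      using card_field_ge_2[where 'a='a] by simp
  qed (use is_mchar_char_pow_generator[OF generator] in auto)
qed

lemma sum_mchars_cnj:
  fixes T :: "'a::{field,finite} \<Rightarrow> complex"
  assumes generator: "char_generator T"
  shows "(\<Sum>\<chi> | is_mchar \<chi>. f \<chi>) = (\<Sum>j<CARD('a) - 1. f (char_cnj (char_pow T j)))"
proof -
  have "(\<Sum>\<chi> | is_mchar \<chi>. f \<chi>) = (\<Sum>\<chi> | is_mchar \<chi>. f (char_cnj \<chi>))"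
    by (rule sum.reindex_bij_witness[of _ char_cnj char_cnj]) auto
  thus ?thesis
    unfolding sum.reindex_bij_betw[OF bij_betw_char_pow_generator[OF generator], symmetric] .
qed

section \<open>Characters of order dividing \<open>d\<close>\<close>

locale residue_characters =
  fixes T :: "'a::{field,finite} \<Rightarrow> complex" and d t :: nat
  assumes generator: "char_generator T"
    and index: "d * t = CARD('a) - 1"
begin

lemma is_mchar_T: "is_mchar T"
  by (rule is_mchar_generator[OF generator])

lemma is_mchar_char_pow_T: "is_mchar (char_pow T k)"
  by (rule is_mchar_char_pow_generator[OF generator])

lemma d_pos: "d > 0" and t_pos: "t > 0"
  using index card_field_ge_2[where 'a='a] by (auto intro!: gr0I)

lemma of_nat_d_nonzero: "of_nat d \<noteq> (0 :: 'a)"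
  using index by (intro of_nat_dvd_card_minus_1_nonzero) (metis dvd_triv_left)

lemma insert_0_range: "insert 0 {1..<d} = {..<d}"
  using d_pos by auto

lemma char_pow_eq_iff: "char_pow T i = char_pow T j \<longleftrightarrow> [i = j] (mod (d * t))"
  by (simp add: char_pow_generator_eq_iff[OF generator] index)

lemma char_pow_mult_t_eq_triv_iff: "char_pow T (i * t) = triv_char \<longleftrightarrow> d dvd i"
  using t_pos unfolding char_pow_generator_eq_triv_iff[OF generator] index[symmetric] by simp

lemma char_pow_d_mult_eq_triv_iff: "char_pow T (d * j) = triv_char \<longleftrightarrow> t dvd j"
  using d_pos unfolding char_pow_generator_eq_triv_iff[OF generator] index[symmetric] by simp

lemma sum_char_pow_mult_t:
  assumes "x \<noteq> 0"
  shows "(\<Sum>i<d. char_pow T (i * t) x) = (if x ^ t = 1 then of_nat d else 0)"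
proof -
  define z where "z = T (x ^ t)"
  have "z ^ d = T (x ^ (CARD('a) - 1))"
    unfolding z_def index[symmetric] mult.commute[of d t] power_mult mchar_power[OF is_mchar_T] ..
  hence "z ^ d = 1"
    by (simp only: field_power_card_minus_1[OF assms] mchar_1[OF is_mchar_T])
  moreover have "(\<Sum>i<d. char_pow T (i * t) x) = (\<Sum>i<d. z ^ i)"
    using assms
    by (simp add: char_pow_def z_def mchar_power[OF is_mchar_T] mult.commute flip: power_mult)
  ultimately show ?thesis
    by (auto simp: sum_gp_strict z_def char_generator_eq_1_iff[OF generator])
qed

end

section \<open>Gauss sums and Jacobi sums\<close>

locale additive_character =
  fixes \<theta> :: "'a::{field,finite} \<Rightarrow> complex"
  assumes theta_add: "\<theta> (x + y) = \<theta> x * \<theta> y"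
    and theta_0: "\<theta> 0 = 1"
    and theta_nontrivial: "\<exists>x. \<theta> x \<noteq> 1"
begin

definition gauss :: "('a \<Rightarrow> complex) \<Rightarrow> complex" where
  "gauss \<chi> = (\<Sum>x\<in>UNIV. \<chi> x * \<theta> x)"

lemma theta_sum: "\<theta> (sum f A) = (\<Prod>i\<in>A. \<theta> (f i))"
  by (induction A rule: infinite_finite_induct) (auto simp: theta_0 theta_add)

lemma sum_theta: "(\<Sum>x\<in>UNIV. \<theta> (a * x)) = (if a = 0 then of_nat CARD('a) else 0)"
proof (cases "a = 0")
  case False
  obtain b where theta_b: "\<theta> b \<noteq> 1" using theta_nontrivial by blast
  have "(\<Sum>x\<in>UNIV. \<theta> (a * x)) = (\<Sum>x\<in>UNIV. \<theta> (b + a * x))"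
    by (rule sum.reindex_bij_witness[of _ "\<lambda>x. x + b / a" "\<lambda>x. x - b / a"])
       (use False in \<open>auto simp: field_simps\<close>)
  also have "\<dots> = \<theta> b * (\<Sum>x\<in>UNIV. \<theta> (a * x))"
    by (simp add: theta_add sum_distrib_left)
  finally show ?thesis using theta_b False by simp
qed (simp add: theta_0)

lemma sum_theta_nonzero:
  "(\<Sum>x\<in>UNIV - {0}. \<theta> (a * x)) = (if a = 0 then of_nat CARD('a) else 0) - 1"
  using sum_theta[of a] by (subst (asm) sum.remove[of _ 0]) (auto simp: theta_0 algebra_simps)

lemma gauss_triv: "gauss triv_char = -1"
proof -
  have "gauss triv_char = (\<Sum>x\<in>UNIV - {0}. \<theta> x)"
    unfolding gauss_def by (rule sum.mono_neutral_cong_right) (auto simp: triv_char_def)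
  also have "\<dots> = -1" using sum_theta_nonzero[of 1] by simp
  finally show ?thesis .
qed

lemma sum_mchar_theta_mult:
  assumes mchar: "is_mchar \<chi>" and nonzero: "z \<noteq> 0"
  shows "(\<Sum>x\<in>UNIV. \<chi> x * \<theta> (z * x)) = cnj (\<chi> z) * gauss \<chi>"
proof -
  have "(\<Sum>x\<in>UNIV. \<chi> x * \<theta> (z * x)) = (\<Sum>x\<in>UNIV. \<chi> (inverse z * x) * \<theta> x)"
    by (rule sum.reindex_bij_witness[of _ "\<lambda>x. x / z" "\<lambda>x. z * x"])
       (use nonzero in \<open>auto simp: field_simps\<close>)
  also have "\<dots> = cnj (\<chi> z) * gauss \<chi>"
    by (simp add: mchar_mult[OF mchar] mchar_inverse[OF mchar] mchar_cnj[OF mchar] gauss_def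
        sum_distrib_left mult_ac)
  finally show ?thesis .
qed

lemma gauss_mult_gauss_cnj:
  assumes mchar: "is_mchar \<chi>" and nontriv: "\<chi> \<noteq> triv_char"
  shows "gauss \<chi> * gauss (char_cnj \<chi>) = \<chi> (-1) * of_nat CARD('a)"
proof -
  have "gauss \<chi> * gauss (char_cnj \<chi>) = (\<Sum>y\<in>UNIV. cnj (\<chi> y) * \<theta> y * gauss \<chi>)"
    by (simp add: gauss_def sum_distrib_left sum_distrib_right mult_ac)
  also have "\<dots> = (\<Sum>y\<in>UNIV - {0}. \<theta> y * (cnj (\<chi> y) * gauss \<chi>))"
    by (rule sum.mono_neutral_cong_right) (auto simp: mchar_0[OF mchar])
  also have "\<dots> = (\<Sum>y\<in>UNIV - {0}. \<theta> y * (\<Sum>u\<in>UNIV. \<chi> u * \<theta> (y * u)))"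
    by (intro sum.cong refl) (simp add: sum_mchar_theta_mult[OF mchar])
  also have "\<dots> = (\<Sum>u\<in>UNIV. \<chi> u * (\<Sum>y\<in>UNIV - {0}. \<theta> ((u + 1) * y)))"
    by (subst sum_distrib_left, subst sum.swap)
       (simp add: sum_distrib_left theta_add algebra_simps)
  also have "\<dots> = (\<Sum>u\<in>UNIV. \<chi> u * (if u = -1 then of_nat CARD('a) else 0) - \<chi> u)"
    unfolding sum_theta_nonzero
    by (intro sum.cong refl) (auto simp: algebra_simps eq_neg_iff_add_eq_0)
  also have "\<dots> = \<chi> (-1) * of_nat CARD('a) - (\<Sum>u\<in>UNIV. \<chi> u)"
    by (simp add: sum_subtractf if_distrib[of "\<lambda>c. _ * c"] cong: if_cong)
  also have "\<dots> = \<chi> (-1) * of_nat CARD('a)" using sum_mchar[OF mchar] nontriv by simp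
  finally show ?thesis .
qed

lemma gauss_nonzero:
  assumes "is_mchar \<chi>"
  shows "gauss \<chi> \<noteq> 0"
proof (cases "\<chi> = triv_char")
  case False
  have "\<chi> (-1) * of_nat CARD('a) \<noteq> 0" by (simp add: mchar_eq_0_iff[OF assms])
  thus ?thesis using gauss_mult_gauss_cnj[OF assms False] by auto
qed (simp add: gauss_triv)

lemma gauss_cnj:
  assumes "is_mchar \<chi>"
  shows "gauss (char_cnj \<chi>) =
    \<chi> (-1) * of_nat CARD('a) / gauss \<chi> + (if \<chi> = triv_char then of_nat CARD('a) - 1 else 0)"
proof (cases "\<chi> = triv_char")
  case False
  thus ?thesis
    using gauss_mult_gauss_cnj[OF assms] gauss_nonzero[OF assms] by (simp add: field_simps)
qed (simp add: gauss_triv, simp add: triv_char_def)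

lemma sum_char_pow_mult_gauss_cnj:
  assumes generator: "char_generator T" and nonzero: "y \<noteq> 0"
  shows "(\<Sum>m<CARD('a) - 1. char_pow T m y * gauss (char_cnj (char_pow T m)))
    = (of_nat CARD('a) - 1) * \<theta> y"
proof -
  note mchar_pow = is_mchar_char_pow_generator[OF generator]
  have "(\<Sum>m<CARD('a) - 1. char_pow T m y * gauss (char_cnj (char_pow T m)))
      = (\<Sum>x\<in>UNIV. (\<Sum>m<CARD('a) - 1. char_pow T m (y * inverse x)) * \<theta> x)"
    unfolding gauss_def sum_distrib_left sum_distrib_right
    by (subst sum.swap)
       (simp add: mchar_mult[OF mchar_pow] mchar_inverse[OF mchar_pow]
         mchar_cnj[OF mchar_pow] mult_ac)
  also have "\<dots> = (\<Sum>x\<in>UNIV. if x = y then (of_nat CARD('a) - 1) * \<theta> y else 0)"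
    unfolding sum_char_pow_generator[OF generator]
    by (intro sum.cong refl) (use nonzero in \<open>auto simp: field_simps\<close>)
  finally show ?thesis by simp
qed

text \<open>Using the quotient by the Gauss sum in place of the conjugate Gauss sum changes only the
  coefficient of the trivial character, and this is what makes the identity hold at \<open>y = 0\<close> too.\<close>

lemma theta_expansion:
  assumes generator: "char_generator T"
  shows "\<theta> y = 1 + of_nat CARD('a) / (of_nat CARD('a) - 1) *
    (\<Sum>m<CARD('a) - 1. char_pow T m (- y) / gauss (char_pow T m))"
proof (cases "y = 0")
  case nonzero: False
  let ?N = "CARD('a) - 1" and ?q = "of_nat CARD('a) :: complex"
  note mchar_pow = is_mchar_char_pow_generator[OF generator]
  have "char_pow T m y * gauss (char_cnj (char_pow T m))
      = ?q * (char_pow T m (- y) / gauss (char_pow T m)) + (if m = 0 then ?q - 1 else 0)"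
    if "m < ?N" for m
  proof -
    have "char_pow T m = triv_char \<longleftrightarrow> m = 0"
      using that by (auto simp: char_pow_generator_eq_triv_iff[OF generator] dest: dvd_imp_le)
    thus ?thesis
      using nonzero
      by (simp add: gauss_cnj[OF mchar_pow] mchar_uminus[OF mchar_pow, of _ y]
          algebra_simps triv_char_def)
  qed
  hence "(?q - 1) * \<theta> y
      = ?q * (\<Sum>m<?N. char_pow T m (- y) / gauss (char_pow T m)) + (?q - 1)"
    unfolding sum_char_pow_mult_gauss_cnj[OF generator nonzero, symmetric]
    using card_field_ge_2[where 'a='a] by (simp add: sum.distrib sum_distrib_left)
  thus ?thesis using of_nat_card_minus_1_nonzero[where 'a='a] by (simp add: field_simps)
qed (simp add: char_pow_def theta_0)

end

definition jacobi_sum ::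
    "('a::{field,finite} \<Rightarrow> complex) \<Rightarrow> ('a \<Rightarrow> complex) \<Rightarrow> complex" where
  "jacobi_sum A B = (\<Sum>x\<in>UNIV. A x * B (1 - x))"

lemma sum_mchar_convolution:
  assumes mchar_A: "is_mchar A" and mchar_B: "is_mchar B" and nontriv: "char_mult A B \<noteq> triv_char"
  shows "(\<Sum>x\<in>UNIV. A x * B (s - x)) = char_mult A B s * jacobi_sum A B"
proof (cases "s = 0")
  case True
  have mchar_AB: "is_mchar (char_mult A B)" using mchar_A mchar_B by auto
  have "A x * B (- x) = B (-1) * char_mult A B x" for x
    using mchar_uminus[OF mchar_B, of x] by (simp add: char_mult_def)
  hence "(\<Sum>x\<in>UNIV. A x * B (- x)) = (\<Sum>x\<in>UNIV. B (-1) * char_mult A B x)"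
    by (rule sum.cong[OF refl])
  also have "\<dots> = 0"
    using sum_mchar[OF mchar_AB] nontriv by (simp flip: sum_distrib_left)
  finally show ?thesis using True by (simp add: mchar_0[OF mchar_AB])
next
  case False
  hence "s * (1 - x / s) = s - x" for x by (simp add: field_simps)
  hence "(\<Sum>x\<in>UNIV. A x * B (s - x)) = (\<Sum>x\<in>UNIV. A (s * x) * B (s * (1 - x)))"
    by (intro sum.reindex_bij_witness[of _ "\<lambda>x. s * x" "\<lambda>x. x / s"]) (use False in auto)
  also have "\<dots> = char_mult A B s * jacobi_sum A B"
    by (simp add: mchar_mult[OF mchar_A] mchar_mult[OF mchar_B] char_mult_def jacobi_sum_def
        sum_distrib_left mult_ac)
  finally show ?thesis .
qed

lemma (in additive_character) jacobi_sum_eq_gauss: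
  assumes mchar_A: "is_mchar A" and mchar_B: "is_mchar B" and nontriv: "char_mult A B \<noteq> triv_char"
  shows "jacobi_sum A B = gauss A * gauss B / gauss (char_mult A B)"
proof -
  have "gauss A * gauss B = (\<Sum>x\<in>UNIV. \<Sum>y\<in>UNIV. A x * B y * \<theta> (x + y))"
    by (simp add: gauss_def sum_product theta_add mult_ac)
  also have "\<dots> = (\<Sum>x\<in>UNIV. \<Sum>s\<in>UNIV. A x * B (s - x) * \<theta> s)"
  proof (rule sum.cong[OF refl])
    fix x :: 'a
    show "(\<Sum>y\<in>UNIV. A x * B y * \<theta> (x + y)) = (\<Sum>s\<in>UNIV. A x * B (s - x) * \<theta> s)"
      by (rule sum.reindex_bij_witness[of _ "\<lambda>s. s - x" "\<lambda>y. x + y"]) auto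
  qed
  also have "\<dots> = (\<Sum>s\<in>UNIV. (\<Sum>x\<in>UNIV. A x * B (s - x)) * \<theta> s)"
    by (subst sum.swap) (simp add: sum_distrib_right)
  also have "\<dots> = jacobi_sum A B * gauss (char_mult A B)"
    by (simp add: sum_mchar_convolution[OF assms] gauss_def sum_distrib_left mult_ac)
  finally show ?thesis
    using gauss_nonzero[OF is_mchar_char_mult[OF mchar_A mchar_B]] by simp
qed

section \<open>Field homomorphisms and roots of polynomials\<close>

locale field_hom =
  fixes f :: "'a::field \<Rightarrow> 'b::field"
  assumes hom_1: "f 1 = 1"
    and hom_add: "f (x + y) = f x + f y"
    and hom_mult: "f (x * y) = f x * f y"
begin

lemma hom_0: "f 0 = 0"
  using hom_add[of 0 0] by (metis add_0_right add_cancel_left_right)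

lemma hom_uminus: "f (- x) = - f x"
  using hom_add[of x "- x"] by (simp add: hom_0 eq_neg_iff_add_eq_0 add.commute)

lemma hom_sum: "f (\<Sum>i\<in>A. g i) = (\<Sum>i\<in>A. f (g i))"
  by (induction A rule: infinite_finite_induct) (simp_all add: hom_0 hom_add)

lemma hom_power: "f (x ^ n) = f x ^ n"
  by (induction n) (simp_all add: hom_1 hom_mult)

lemma hom_eq_0_iff: "f x = 0 \<longleftrightarrow> x = 0"
proof
  show "x = 0" if "f x = 0"
    using that hom_mult[of x "inverse x"] by (cases "x = 0") (auto simp: hom_1)
qed (simp add: hom_0)

lemma hom_eq_iff: "f x = f y \<longleftrightarrow> x = y"
  using hom_eq_0_iff[of "x - y"] hom_add[of "x - y" y] by auto

lemma map_poly_hom_add: "map_poly f (p + q) = map_poly f p + map_poly f q"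
  by (rule poly_eqI) (simp add: coeff_map_poly hom_0 hom_add)

lemma map_poly_hom_mult: "map_poly f (p * q) = map_poly f p * map_poly f q"
  by (rule poly_eqI) (simp add: coeff_map_poly coeff_mult hom_0 hom_sum hom_mult)

lemma map_poly_hom_prod: "map_poly f (\<Prod>i\<in>A. p i) = (\<Prod>i\<in>A. map_poly f (p i))"
  by (induction A rule: infinite_finite_induct)
     (simp_all add: map_poly_hom_mult map_poly_1' hom_1)

lemma map_poly_hom_power: "map_poly f (p ^ n) = map_poly f p ^ n"
  by (induction n) (simp_all add: map_poly_hom_mult map_poly_1' hom_1)

lemma degree_map_poly_hom: "degree (map_poly f p) = degree p"
  by (rule degree_map_poly) (simp add: hom_eq_0_iff)

lemma map_poly_hom_eq_0_iff: "map_poly f p = 0 \<longleftrightarrow> p = 0"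
  by (rule map_poly_eq_0_iff) (simp_all add: hom_eq_0_iff)

lemma poly_map_poly_hom: "poly (map_poly f p) (f x) = f (poly p x)"
  by (induction p) (simp_all add: map_poly_pCons hom_0 hom_add hom_mult)

lemma map_poly_hom_dvd_iff: "map_poly f p dvd map_poly f q \<longleftrightarrow> p dvd q"
proof
  assume dvd: "map_poly f p dvd map_poly f q"
  show "p dvd q"
  proof (cases "p = 0")
    case False
    have "map_poly f q = map_poly f (q div p) * map_poly f p + map_poly f (q mod p)"
      by (simp flip: map_poly_hom_mult map_poly_hom_add)
    hence "map_poly f p dvd map_poly f (q mod p)"
      using dvd by (metis dvd_add_right_iff dvd_triv_right)
    hence "degree p \<le> degree (q mod p)" if "q mod p \<noteq> 0"
      using dvd_imp_degree_le[of "map_poly f p" "map_poly f (q mod p)"] that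
      by (simp add: map_poly_hom_eq_0_iff degree_map_poly_hom)
    hence "q mod p = 0" using degree_mod_less[OF False, of q] by force
    thus ?thesis by auto
  qed (use dvd in \<open>simp add: map_poly_hom_eq_0_iff\<close>)
qed (auto simp: dvd_def map_poly_hom_mult)

lemma order_map_poly_hom_ge:
  assumes "p \<noteq> 0"
  shows "order x p \<le> order (f x) (map_poly f p)"
proof -
  have "map_poly f ([:-x, 1:] ^ order x p) dvd map_poly f p"
    by (simp add: map_poly_hom_dvd_iff order_1)
  moreover have "map_poly f ([:-x, 1:] ^ order x p) = [:- f x, 1:] ^ order x p"
    by (simp add: map_poly_hom_power map_poly_pCons hom_0 hom_1 hom_uminus)
  ultimately show ?thesis using assms by (simp add: order_divides map_poly_hom_eq_0_iff)
qed

end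

lemma unit_linear_power_dvd_iff:
  fixes P :: "'a::field poly"
  assumes "c \<noteq> 0" "P \<noteq> 0"
  shows "[:1, - c:] ^ r dvd P \<longleftrightarrow> r \<le> order (inverse c) P"
proof -
  have "[:1, - c:] = smult (- c) [:- inverse c, 1:]" using assms by simp
  thus ?thesis using assms by (simp only: smult_power smult_dvd_iff order_divides) simp
qed

lemma prod_unit_linear_power_dvd_iff:
  fixes P :: "'a::field poly"
  assumes "finite S" "P \<noteq> 0" "0 \<notin> S"
  shows "(\<Prod>c\<in>S. [:1, - c:]) ^ r dvd P \<longleftrightarrow> (\<forall>c\<in>S. r \<le> order (inverse c) P)"
  unfolding prod_power_distrib
proof
  assume "(\<Prod>c\<in>S. [:1, - c:] ^ r) dvd P"
  hence "[:1, - c:] ^ r dvd P" if "c \<in> S" for c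
    using assms(1) that by (meson dvd_prodI dvd_trans)
  thus "\<forall>c\<in>S. r \<le> order (inverse c) P"
    using assms by (metis unit_linear_power_dvd_iff)
next
  assume "\<forall>c\<in>S. r \<le> order (inverse c) P"
  with assms show "(\<Prod>c\<in>S. [:1, - c:] ^ r) dvd P"
  proof (induction S rule: finite_induct)
    case (insert c S)
    define R where "R = (\<Prod>b\<in>S. [:1, - b:] ^ r)"
    obtain Q where P_eq: "P = R * Q" using insert by (auto simp: R_def)
    have "poly R (inverse c) \<noteq> 0"
      using insert by (auto simp: R_def poly_prod field_simps)
    hence "order (inverse c) R = 0" by (rule order_0I)
    hence "order (inverse c) P = order (inverse c) Q"
      using insert.prems by (simp add: P_eq order_mult)
    hence "[:1, - c:] ^ r dvd Q"
      using insert.prems by (intro iffD2[OF unit_linear_power_dvd_iff]) (auto simp: P_eq)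
    thus ?case using insert.hyps P_eq by (simp add: R_def[symmetric] mult.commute mult_dvd_mono)
  qed simp
qed

lemma sum_order_eq_degree:
  fixes P :: "'a::alg_closed_field poly"
  assumes "P \<noteq> 0"
  shows "(\<Sum>x | poly P x = 0. order x P) = degree P"
proof -
  obtain A where factorization: "size A = degree P" "P = smult (lead_coeff P) (\<Prod>x\<in>#A. [:-x, 1:])"
    using alg_closed_imp_factorization[OF assms] by blast
  have "proots P = proots (smult (lead_coeff P) (\<Prod>x\<in>#A. [:-x, 1:]))"
    using factorization(2) by simp
  also have "\<dots> = proots (\<Prod>p\<in>#{#[:-x, 1:]. x \<in># A#}. p)"
    using assms by simp
  also have "\<dots> = (\<Sum>p\<in>#{#[:-x, 1:]. x \<in># A#}. proots p)"
    by (rule proots_prod_mset) auto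
  also have "\<dots> = A" by (simp add: image_mset.compositionality o_def)
  finally have "size (proots P) = degree P" using factorization(1) by simp
  thus ?thesis using assms by (simp add: size_multiset_overloaded_eq)
qed

lemma card_roots_eq_degree:
  fixes P :: "'a::alg_closed_field poly"
  assumes "P \<noteq> 0" and simple: "\<And>x. poly P x = 0 \<Longrightarrow> poly (pderiv P) x \<noteq> 0"
  shows "card {x. poly P x = 0} = degree P"
proof -
  have "order x P = 1" if root: "poly P x = 0" for x
  proof -
    obtain Q where P_eq: "P = [:-x, 1:] * Q" using root by (auto simp: poly_eq_0_iff_dvd)
    have "poly (pderiv P) x = poly Q x"
      unfolding P_eq pderiv_mult by (simp add: pderiv_pCons)
    hence "order x Q = 0" using simple[OF root] by (intro order_0I) simp
    moreover have "order x [:-x, 1:] = 1" using order_power_n_n[of x 1] by simp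
    ultimately show ?thesis using assms(1) unfolding P_eq by (subst order_mult) auto
  qed
  hence "(\<Sum>x | poly P x = 0. order x P) = card {x. poly P x = 0}" by simp
  thus ?thesis using sum_order_eq_degree[OF assms(1)] by simp
qed

lemma card_nth_roots_alg_closed:
  fixes y :: "'a::alg_closed_field"
  assumes y_nonzero: "y \<noteq> 0" and n_nonzero: "of_nat n \<noteq> (0 :: 'a)"
  shows "card {x. x ^ n = y} = n"
proof -
  have n_pos: "n > 0" using n_nonzero by (intro gr0I) auto
  define P where "P = monom (1 :: 'a) n - [:y:]"
  have roots: "poly P x = 0 \<longleftrightarrow> x ^ n = y" for x by (simp add: P_def poly_monom)
  have degree_P: "degree P = n"
    unfolding P_def diff_conv_add_uminus using n_pos
    by (subst degree_add_eq_left) (simp_all add: degree_monom_eq)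
  hence "P \<noteq> 0" using n_pos by auto
  moreover have "poly (pderiv P) x \<noteq> 0" if "poly P x = 0" for x
  proof -
    have "x \<noteq> 0" using that y_nonzero n_pos by (auto simp: roots power_0_left)
    thus ?thesis using n_nonzero
      by (simp add: P_def pderiv_diff pderiv_monom poly_monom pderiv_pCons)
  qed
  ultimately show ?thesis using card_roots_eq_degree[of P] by (simp add: degree_P roots)
qed

section \<open>The Frobenius maps of the algebraic closure\<close>

global_interpretation to_ac: field_hom to_ac
  by standard auto

lemma power_card_add_alg_closure:
  fixes x y :: "'a::{field,finite} alg_closure"
  shows "(x + y) ^ CARD('a) = x ^ CARD('a) + y ^ CARD('a)"
proof (cases "y = 0")
  case False
  let ?q = "CARD('a)" and ?P = "[:1, 1:] :: 'a poly"
  have "?P ^ ?q = monom 1 ?q + 1"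
  proof (rule poly_eqI_degree_lead_coeff)
    show "coeff (?P ^ ?q) ?q = coeff (monom 1 ?q + 1) ?q"
      using lead_coeff_power[of ?P ?q] by (simp add: degree_linear_power)
    show "degree (monom 1 ?q + 1 :: 'a poly) \<le> ?q"
      by (intro degree_add_le) (simp_all add: degree_monom_le)
  qed (auto simp: degree_linear_power poly_monom field_power_card add.commute)
  hence "map_poly to_ac (?P ^ ?q) = map_poly to_ac (monom 1 ?q + 1)" by simp
  hence "[:1, 1:] ^ ?q = (monom 1 ?q + 1 :: 'a alg_closure poly)"
    by (simp add: to_ac.map_poly_hom_power to_ac.map_poly_hom_add map_poly_pCons map_poly_monom)
  hence "poly ([:1, 1:] ^ ?q) (x / y) = poly (monom 1 ?q + 1) (x / y)" by simp
  hence "(1 + x / y) ^ ?q * y ^ ?q = ((x / y) ^ ?q + 1) * y ^ ?q" by (simp add: poly_monom)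
  hence "((1 + x / y) * y) ^ ?q = (x / y * y) ^ ?q + y ^ ?q"
    unfolding power_mult_distrib by (simp only: distrib_right mult_1)
  thus ?thesis using False by (simp add: distrib_right add.commute)
qed simp

definition frob :: "nat \<Rightarrow> 'a::{field,finite} alg_closure \<Rightarrow> 'a alg_closure" where
  "frob k x = x ^ (CARD('a) ^ k)"

lemma frob_0 [simp]: "frob 0 x = x"
  by (simp add: frob_def)

lemma frob_frob: "frob i (frob j x) = frob (i + j) x"
  by (simp add: frob_def power_add mult.commute flip: power_mult)

global_interpretation frob: field_hom "frob k" for k
proof
  fix x y :: "'a alg_closure"
  show "frob k (x + y) = frob k x + frob k y"
  proof (induction k)
    case (Suc k)
    have frob_Suc: "frob (Suc k) z = frob k z ^ CARD('a)" for z :: "'a alg_closure"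
      by (simp add: frob_def mult.commute flip: power_mult)
    show ?case by (simp only: frob_Suc Suc power_card_add_alg_closure)
  qed simp
qed (auto simp: frob_def power_mult_distrib)

lemma frob_to_ac: "frob k (to_ac x) = to_ac x"
  for x :: "'a::{field,finite}"
proof (induction k)
  case (Suc k)
  have "frob 1 (to_ac x) = to_ac x"
    by (simp add: frob_def field_power_card flip: to_ac_power)
  thus ?case using Suc frob_frob[of 1 k "to_ac x"] by simp
qed simp

lemma map_poly_frob_to_ac: "map_poly (frob k) (map_poly to_ac P) = map_poly to_ac P"
  for P :: "'a::{field,finite} poly"
  by (rule poly_eqI) (simp add: coeff_map_poly frob.hom_0 frob_to_ac)

lemma order_frob_ge:
  fixes P :: "'a::{field,finite} poly"
  assumes "P \<noteq> 0"
  shows "order x (map_poly to_ac P) \<le> order (frob k x) (map_poly to_ac P)"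
  using frob.order_map_poly_hom_ge[of "map_poly to_ac P" x k] assms
  by (simp add: map_poly_frob_to_ac to_ac.map_poly_hom_eq_0_iff)

lemma frob_fixed_points:
  assumes "k > 0"
  shows "finite {x :: 'a::{field,finite} alg_closure. frob k x = x}"
    and "card {x :: 'a alg_closure. frob k x = x} \<le> CARD('a) ^ k"
proof -
  let ?N = "CARD('a) ^ k"
  define P where "P = monom (1 :: 'a alg_closure) ?N - monom 1 1"
  have "CARD('a) ^ 1 \<le> ?N"
    using assms card_field_ge_2[where 'a='a] by (intro power_increasing) auto
  hence "?N > 1" using card_field_ge_2[where 'a='a] by simp
  hence "coeff P ?N = 1" and degree_le: "degree P \<le> ?N"
    by (auto simp: P_def degree_monom_eq intro!: degree_diff_le)
  hence "P \<noteq> 0" by auto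
  moreover have "{x. poly P x = 0} = {x :: 'a alg_closure. frob k x = x}"
    by (auto simp: P_def poly_monom frob_def)
  ultimately show "finite {x :: 'a alg_closure. frob k x = x}"
    "card {x :: 'a alg_closure. frob k x = x} \<le> ?N"
    using poly_roots_finite[of P] card_poly_roots_bound[of P] degree_le by auto
qed

lemma frob_1_fixed_iff: "frob 1 x = x \<longleftrightarrow> x \<in> range to_ac"
  for x :: "'a::{field,finite} alg_closure"
proof -
  have "card (range (to_ac :: 'a \<Rightarrow> 'a alg_closure)) = CARD('a)"
    by (intro card_image inj_to_ac)
  hence "range (to_ac :: 'a \<Rightarrow> _) = {x. frob 1 x = x}"
    using frob_fixed_points[of 1, where 'a='a] by (intro card_seteq) (auto simp: frob_to_ac)
  thus ?thesis by auto
qed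

lemma frob_mult_period:
  assumes "frob m b = b"
  shows "frob (m * r) b = b"
  by (induction r) (simp_all add: assms flip: frob_frob)

lemma frob_periodic: "\<exists>m>0. frob m b = b"
  for b :: "'a::{field,finite} alg_closure"
proof -
  obtain P :: "'a poly" where P_root: "P \<noteq> 0" "poly (map_poly to_ac P) b = 0"
    by (rule alg_closure_algebraic)
  have "poly (map_poly to_ac P) (frob j b) = 0" for j
    using frob.poly_map_poly_hom[of j "map_poly to_ac P" b] P_root(2)
    by (simp add: map_poly_frob_to_ac frob.hom_0)
  hence "range (\<lambda>j. frob j b) \<subseteq> {x. poly (map_poly to_ac P) x = 0}" by auto
  moreover have "finite {x. poly (map_poly to_ac P) x = 0}"
    using P_root(1) by (intro poly_roots_finite) (simp add: to_ac.map_poly_hom_eq_0_iff)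
  ultimately have "finite (range (\<lambda>j. frob j b))" by (rule finite_subset)
  hence "\<not> inj (\<lambda>j. frob j b)" by (metis finite_imageD infinite_UNIV_nat)
  then obtain i j where "frob i b = frob j b" "i < j" by (metis injI linorder_neqE_nat)
  hence "frob i b = frob i (frob (j - i) b)" by (simp add: frob_frob)
  thus ?thesis using \<open>i < j\<close> by (intro exI[of _ "j - i"]) (simp add: frob.hom_eq_iff)
qed

lemma frob_least_period:
  obtains m where "m > 0" "\<And>k. frob k b = b \<longleftrightarrow> m dvd k"
proof -
  define m where "m = (LEAST m. m > 0 \<and> frob m b = b)"
  have period: "m > 0" "frob m b = b"
    using LeastI_ex[OF frob_periodic[of b, unfolded Bex_def]] by (auto simp: m_def)
  have "m dvd k" if "frob k b = b" for k
  proof (rule ccontr)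
    assume "\<not> m dvd k"
    moreover have "frob (k mod m) b = b"
      using that frob_frob[of "k mod m" "m * (k div m)" b]
      by (simp add: frob_mult_period[OF period(2)])
    ultimately show False
      using not_less_Least[of "k mod m" "\<lambda>m. m > 0 \<and> frob m b = b"] period(1)
      by (auto simp: m_def[symmetric] mod_greater_zero_iff_not_dvd)
  qed
  thus thesis using that[of m] period frob_mult_period[OF period(2)] by (metis dvdE)
qed

lemma inj_on_frob_least_period:
  assumes "\<And>k. frob k b = b \<longleftrightarrow> m dvd k"
  shows "inj_on (\<lambda>j. frob j b) {..<m}"
proof -
  have "frob i b \<noteq> frob j b" if "i < j" "j < m" for i j
  proof
    assume "frob i b = frob j b"
    hence "frob i (frob (j - i) b) = frob i b" using that by (simp add: frob_frob)
    hence "m dvd j - i" by (simp add: frob.hom_eq_iff assms)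
    thus False using that by (auto dest: dvd_imp_le)
  qed
  thus ?thesis by (metis inj_onI lessThan_iff linorder_neqE_nat)
qed

definition fixed_units :: "nat \<Rightarrow> 'a::{field,finite} alg_closure set" where
  "fixed_units k = {b. b \<noteq> 0 \<and> frob k b = b}"

lemma finite_fixed_units: "k > 0 \<Longrightarrow> finite (fixed_units k)"
  using frob_fixed_points(1)[of k] by (rule finite_subset[rotated]) (auto simp: fixed_units_def)

lemma power_fixed_units: "b \<in> fixed_units k \<Longrightarrow> b ^ n \<in> fixed_units k"
  by (auto simp: fixed_units_def frob.hom_power)

lemma fixed_units_1: "fixed_units 1 = to_ac ` (UNIV - {0 :: 'a::{field,finite}})"
  unfolding fixed_units_def using frob_1_fixed_iff[where 'a='a] by auto

section \<open>Logarithmic derivatives and power sums\<close>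

definition log_deriv :: "'a::field fps \<Rightarrow> 'a fps" where
  "log_deriv F = fps_X * fps_deriv F * inverse F"

lemma log_deriv_eqI:
  assumes "fps_nth F 0 \<noteq> 0" "fps_X * fps_deriv F = F * L"
  shows "log_deriv F = L"
proof -
  have "log_deriv F = (F * inverse F) * L" by (simp add: log_deriv_def assms(2) mult_ac)
  thus ?thesis using assms(1) by (simp add: inverse_mult_eq_1')
qed

lemma fps_mult_log_deriv:
  assumes "fps_nth F 0 \<noteq> 0"
  shows "F * log_deriv F = fps_X * fps_deriv F"
proof -
  have "F * log_deriv F = (F * inverse F) * (fps_X * fps_deriv F)"
    by (simp add: log_deriv_def mult_ac)
  thus ?thesis using assms by (simp add: inverse_mult_eq_1')
qed

lemma log_deriv_1: "log_deriv 1 = 0"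
  by (simp add: log_deriv_def)

lemma log_deriv_mult:
  assumes "fps_nth F 0 \<noteq> 0" "fps_nth G 0 \<noteq> 0"
  shows "log_deriv (F * G) = log_deriv F + log_deriv G"
proof (rule log_deriv_eqI)
  have "fps_X * fps_deriv (F * G) = F * (fps_X * fps_deriv G) + G * (fps_X * fps_deriv F)"
    by (simp add: algebra_simps)
  also have "\<dots> = F * G * (log_deriv F + log_deriv G)"
    using assms by (simp add: algebra_simps flip: fps_mult_log_deriv)
  finally show "fps_X * fps_deriv (F * G) = F * G * (log_deriv F + log_deriv G)" .
qed (use assms in simp)

lemma fps_nth_0_prod: "fps_nth (\<Prod>i\<in>A. F i) 0 = (\<Prod>i\<in>A. fps_nth (F i) 0)"
  for F :: "'b \<Rightarrow> 'a::comm_ring_1 fps"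
  by (induction A rule: infinite_finite_induct) simp_all

lemma log_deriv_prod:
  assumes "\<And>i. i \<in> A \<Longrightarrow> fps_nth (F i) 0 \<noteq> 0"
  shows "log_deriv (\<Prod>i\<in>A. F i) = (\<Sum>i\<in>A. log_deriv (F i))"
  using assms
proof (induction A rule: infinite_finite_induct)
  case (insert x A)
  hence "fps_nth (\<Prod>i\<in>A. F i) 0 \<noteq> 0" by (simp add: fps_nth_0_prod)
  thus ?case using insert by (simp add: log_deriv_mult)
qed (auto simp: log_deriv_1)

lemma log_deriv_eq_imp_eq:
  fixes F G :: "'a::field_char_0 fps"
  assumes log_deriv_eq: "log_deriv F = log_deriv G"
    and "fps_nth F 0 = fps_nth G 0" "fps_nth G 0 \<noteq> 0"
  shows "F = G"
proof -
  define Q where "Q = F * inverse G"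
  have F_eq: "F = Q * G" using assms(3) by (simp add: Q_def mult.assoc inverse_mult_eq_1)
  have Q_nth_0: "fps_nth Q 0 = 1" using assms(2,3) by (simp add: Q_def)
  have "log_deriv Q = 0" using log_deriv_eq log_deriv_mult[of Q G] assms(3)
    by (simp add: F_eq Q_nth_0)
  hence "fps_X * fps_deriv Q = 0" using fps_mult_log_deriv[of Q] Q_nth_0 by simp
  hence "Q = 1" using Q_nth_0 by (simp add: fps_deriv_eq_0_iff)
  thus ?thesis by (simp add: F_eq)
qed

lemma log_deriv_linear:
  "log_deriv (1 + fps_const c * fps_X) = Abs_fps (\<lambda>n. if n = 0 then 0 else - ((- c) ^ n))"
proof (rule log_deriv_eqI)
  let ?L = "Abs_fps (\<lambda>n. if n = 0 then 0 else - ((- c) ^ n))"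
  show "fps_X * fps_deriv (1 + fps_const c * fps_X) = (1 + fps_const c * fps_X) * ?L"
  proof (rule fps_ext)
    fix n
    show "fps_nth (fps_X * fps_deriv (1 + fps_const c * fps_X)) n
      = fps_nth ((1 + fps_const c * fps_X) * ?L) n"
      by (cases n) (auto simp: ring_distribs mult.assoc)
  qed
qed simp

lemma fps_nth_log_deriv_add_X_power:
  assumes F_nth_0: "fps_nth F 0 = 1" and n_pos: "n > 0"
  shows "fps_nth (log_deriv (F + fps_const c * fps_X ^ n)) n
    = fps_nth (log_deriv F) n + of_nat n * c"
proof -
  define H where "H = fps_const c * inverse F"
  define K where "K = 1 + fps_X ^ n * H"
  have K_nth_0: "fps_nth K 0 = 1" using n_pos by (simp add: K_def)
  have "F * K = F + fps_const c * fps_X ^ n * (F * inverse F)"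
    by (simp add: K_def H_def algebra_simps)
  hence "F + fps_const c * fps_X ^ n = F * K" using F_nth_0 by (simp add: inverse_mult_eq_1')
  hence "log_deriv (F + fps_const c * fps_X ^ n) = log_deriv F + log_deriv K"
    using F_nth_0 K_nth_0 by (simp add: log_deriv_mult)
  moreover have "fps_nth (log_deriv K) n = of_nat n * c"
  proof -
    have "fps_X * fps_X ^ (n - Suc 0) = (fps_X ^ n :: 'a fps)" using n_pos by (cases n) auto
    hence "fps_X * fps_deriv K = fps_X ^ n * (fps_const (of_nat n) * H + fps_X * fps_deriv H)"
      by (simp add: K_def fps_deriv_power distrib_left mult_ac)
    hence "log_deriv K =
        fps_X ^ n * ((fps_const (of_nat n) * H + fps_X * fps_deriv H) * inverse K)"
      by (simp add: log_deriv_def mult.assoc)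
    thus ?thesis using F_nth_0 K_nth_0 by (simp add: fps_X_power_mult_nth H_def)
  qed
  ultimately show ?thesis by simp
qed

text \<open>For \<open>P = \<Prod>\<^sub>i (1 - c\<^sub>i X)\<close> and \<open>n > 0\<close> this is \<open>\<Sum>\<^sub>i c\<^sub>i\<^sup>n\<close>, read off
  from the logarithmic derivative so that it makes sense over the field of coefficients.\<close>

definition power_sum :: "nat \<Rightarrow> 'a::field poly \<Rightarrow> 'a" where
  "power_sum n P = - fps_nth (log_deriv (fps_of_poly P)) n"

lemma power_sum_1: "power_sum n 1 = 0"
  by (simp add: power_sum_def log_deriv_1)

lemma power_sum_mult:
  assumes "poly P 0 = 1" "poly Q 0 = 1"
  shows "power_sum n (P * Q) = power_sum n P + power_sum n Q"
  using assms by (simp add: power_sum_def fps_of_poly_mult log_deriv_mult poly_0_coeff_0)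

lemma power_sum_prod_linear:
  assumes "n > 0"
  shows "power_sum n (\<Prod>i\<in>A. [:1, - c i:]) = (\<Sum>i\<in>A. c i ^ n)"
proof -
  have "log_deriv (fps_of_poly (\<Prod>i\<in>A. [:1, - c i:]))
      = (\<Sum>i\<in>A. log_deriv (1 + fps_const (- c i) * fps_X))"
    unfolding fps_of_poly_prod fps_of_poly_linear' by (rule log_deriv_prod) simp
  thus ?thesis
    using assms unfolding power_sum_def log_deriv_linear by (simp add: fps_sum_nth sum_negf)
qed

lemma power_sum_add_monom:
  assumes "poly P 0 = 1" "n > 0"
  shows "power_sum n (P + monom c n) = power_sum n P - of_nat n * c"
  using fps_nth_log_deriv_add_X_power[of "fps_of_poly P" n c] assms
  by (simp add: power_sum_def fps_of_poly_add fps_of_poly_monom poly_0_coeff_0)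

lemma (in field_hom) power_sum_map_poly_hom:
  assumes "poly P 0 = 1"
  shows "power_sum n (map_poly f P) = f (power_sum n P)"
proof -
  define h where "h F = Abs_fps (\<lambda>i. f (fps_nth F i))" for F
  have h_mult: "h (F * G) = h F * h G" for F G
    by (rule fps_ext) (simp add: h_def fps_mult_nth hom_sum hom_mult)
  have of_nat: "f (of_nat i) = of_nat i" for i
    by (induction i) (simp_all add: hom_0 hom_1 hom_add)
  have h_deriv: "h (fps_X * fps_deriv F) = fps_X * fps_deriv (h F)" for F
    by (rule fps_ext) (simp add: h_def hom_0 hom_mult of_nat del: of_nat_Suc)
  have P_nth_0: "fps_nth (fps_of_poly P) 0 = 1" using assms by (simp add: poly_0_coeff_0)
  have "fps_of_poly (map_poly f P) = h (fps_of_poly P)"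
    by (rule fps_ext) (simp add: h_def coeff_map_poly hom_0)
  moreover have "log_deriv (h (fps_of_poly P)) = h (log_deriv (fps_of_poly P))"
  proof (rule log_deriv_eqI)
    show "fps_nth (h (fps_of_poly P)) 0 \<noteq> 0" using P_nth_0 by (simp add: h_def hom_1)
    show "fps_X * fps_deriv (h (fps_of_poly P))
      = h (fps_of_poly P) * h (log_deriv (fps_of_poly P))"
      using P_nth_0 by (simp add: fps_mult_log_deriv flip: h_deriv h_mult)
  qed
  ultimately show ?thesis by (simp add: power_sum_def h_def hom_uminus)
qed

section \<open>Norms of linear polynomials\<close>

definition conj_poly ::
    "nat \<Rightarrow> 'a::{field,finite} alg_closure \<Rightarrow> 'a alg_closure poly" where
  "conj_poly k b = (\<Prod>j<k. [:1, - frob j b:])"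

definition norm_poly :: "nat \<Rightarrow> 'a::{field,finite} alg_closure \<Rightarrow> 'a poly" where
  "norm_poly k b = map_poly of_ac (conj_poly k b)"

lemma conj_poly_add: "conj_poly (i + j) b = conj_poly i b * conj_poly j (frob i b)"
proof (induction j)
  case (Suc j)
  have "conj_poly (i + Suc j) b = conj_poly (i + j) b * [:1, - frob (j + i) b:]"
    unfolding conj_poly_def add_Suc_right prod.lessThan_Suc add.commute[of j i] ..
  thus ?case
    unfolding Suc by (simp only: conj_poly_def prod.lessThan_Suc frob_frob mult.assoc)
qed (simp add: conj_poly_def)

lemma conj_poly_mult_period:
  assumes "frob m b = b"
  shows "conj_poly (m * r) b = conj_poly m b ^ r"
proof (induction r)
  case (Suc r)
  have "conj_poly (m * Suc r) b = conj_poly m b * conj_poly (m * r) b"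
    by (simp add: conj_poly_add assms)
  thus ?case using Suc by simp
qed (simp add: conj_poly_def)

lemma poly_conj_poly_0: "poly (conj_poly k b) 0 = 1"
  by (simp add: conj_poly_def poly_prod)

lemma degree_conj_poly: "b \<noteq> 0 \<Longrightarrow> degree (conj_poly k b) = k"
  unfolding conj_poly_def
  by (subst degree_prod_eq_sum_degree) (auto simp: frob.hom_eq_0_iff)

lemma conj_poly_dvd_imp_le_degree:
  assumes "conj_poly k b dvd Q" "b \<noteq> 0" "Q \<noteq> 0"
  shows "k \<le> degree Q"
  using dvd_imp_degree_le[OF assms(1,3)] degree_conj_poly[OF assms(2)] by simp

lemma conj_poly_dvd_imp_root:
  assumes "conj_poly k b dvd Q" "b \<noteq> 0" "k > 0"
  shows "poly Q (inverse b) = 0"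
proof -
  have "poly (conj_poly k b) (inverse b) = 0"
    unfolding conj_poly_def poly_prod using assms(2,3) by (intro prod_zero bexI[of _ 0]) auto
  thus ?thesis using assms(1) by (auto elim!: dvdE)
qed

lemma map_poly_frob_conj_poly:
  assumes "frob k b = b"
  shows "map_poly (frob 1) (conj_poly k b) = conj_poly k b"
proof -
  have "map_poly (frob 1) (conj_poly k b) = conj_poly k (frob 1 b)"
    by (simp add: conj_poly_def frob.map_poly_hom_prod map_poly_pCons frob.hom_0 frob.hom_1
        frob.hom_uminus frob_frob)
  moreover have "conj_poly 1 b * conj_poly k (frob 1 b) = conj_poly 1 b * conj_poly k b"
    using conj_poly_add[of 1 k b] conj_poly_add[of k 1 b] assms by (simp add: mult.commute)
  moreover have "conj_poly 1 b \<noteq> 0" by (simp add: conj_poly_def)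
  ultimately show ?thesis by simp
qed

lemma map_poly_to_ac_norm_poly:
  assumes "frob k b = b"
  shows "map_poly to_ac (norm_poly k b) = conj_poly k b"
proof (rule poly_eqI)
  fix i
  have "frob 1 (coeff (conj_poly k b) i) = coeff (conj_poly k b) i"
    using arg_cong[OF map_poly_frob_conj_poly[OF assms], of "\<lambda>P. coeff P i"]
    by (simp add: coeff_map_poly frob.hom_0)
  hence "coeff (conj_poly k b) i \<in> range to_ac" unfolding frob_1_fixed_iff .
  thus "coeff (map_poly to_ac (norm_poly k b)) i = coeff (conj_poly k b) i"
    by (simp add: norm_poly_def coeff_map_poly to_ac_of_ac)
qed

lemma norm_poly_dvd_iff:
  "frob k b = b \<Longrightarrow> norm_poly k b dvd P \<longleftrightarrow> conj_poly k b dvd map_poly to_ac P"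
  using to_ac.map_poly_hom_dvd_iff[of "norm_poly k b" P] by (simp only: map_poly_to_ac_norm_poly)

lemma conj_poly_mult_dvd_iff:
  fixes P :: "'a::{field,finite} poly"
  assumes P_nonzero: "P \<noteq> 0" and b_nonzero: "b \<noteq> 0"
    and period: "m > 0" "\<And>k. frob k b = b \<longleftrightarrow> m dvd k"
  shows "conj_poly (m * r) b dvd map_poly to_ac P \<longleftrightarrow> r \<le> order (inverse b) (map_poly to_ac P)"
proof -
  let ?O = "(\<lambda>j. frob j b) ` {..<m}"
  have inj_orbit: "inj_on (\<lambda>j. frob j b) {..<m}"
    using period(2) by (rule inj_on_frob_least_period)
  have "conj_poly (m * r) b = (\<Prod>c\<in>?O. [:1, - c:]) ^ r"
    using period
    by (simp add: conj_poly_mult_period) (simp add: conj_poly_def prod.reindex[OF inj_orbit])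
  hence "conj_poly (m * r) b dvd map_poly to_ac P \<longleftrightarrow>
      (\<forall>c\<in>?O. r \<le> order (inverse c) (map_poly to_ac P))"
    using P_nonzero b_nonzero
    by (simp only:) (intro prod_unit_linear_power_dvd_iff,
      auto simp: to_ac.map_poly_hom_eq_0_iff frob.hom_eq_0_iff)
  also have "\<dots> \<longleftrightarrow> r \<le> order (inverse b) (map_poly to_ac P)"
  proof
    assume "\<forall>c\<in>?O. r \<le> order (inverse c) (map_poly to_ac P)"
    moreover have "frob 0 b \<in> ?O" using period(1) by blast
    ultimately have "r \<le> order (inverse (frob 0 b)) (map_poly to_ac P)" by (rule bspec)
    thus "r \<le> order (inverse b) (map_poly to_ac P)" by simp
  next
    assume "r \<le> order (inverse b) (map_poly to_ac P)"
    thus "\<forall>c\<in>?O. r \<le> order (inverse c) (map_poly to_ac P)"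
      using order_frob_ge[OF P_nonzero, of "inverse b"]
      by (auto simp: frob_def power_inverse intro: order.trans)
  qed
  finally show ?thesis .
qed

lemma card_conj_poly_dvd:
  fixes P :: "'a::{field,finite} poly"
  assumes P_nonzero: "P \<noteq> 0" and b_nonzero: "b \<noteq> 0"
  defines "S \<equiv> {k. k > 0 \<and> frob k b = b \<and> conj_poly k b dvd map_poly to_ac P}"
  shows "finite S" and "card S = order (inverse b) (map_poly to_ac P)"
proof -
  obtain m where period: "m > 0" "\<And>k. frob k b = b \<longleftrightarrow> m dvd k" using frob_least_period by blast
  have "S = (\<lambda>r. m * r) ` {r. m * r > 0 \<and> conj_poly (m * r) b dvd map_poly to_ac P}"
    unfolding S_def period(2) by (auto simp del: nat_0_less_mult_iff elim!: dvdE[of m])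
  also have "{r. m * r > 0 \<and> conj_poly (m * r) b dvd map_poly to_ac P}
      = {1..order (inverse b) (map_poly to_ac P)}"
    unfolding conj_poly_mult_dvd_iff[OF P_nonzero b_nonzero period] using period(1) by auto
  finally have S_eq: "S = (\<lambda>r. m * r) ` {1..order (inverse b) (map_poly to_ac P)}" .
  show "finite S" "card S = order (inverse b) (map_poly to_ac P)"
    unfolding S_eq using period(1) by (auto simp: card_image inj_on_def)
qed

section \<open>L-series over polynomials with constant term 1\<close>

definition unit_polys :: "nat \<Rightarrow> 'a::field poly set" where
  "unit_polys m = {P. poly P 0 = 1 \<and> degree P = m}"

definition short_unit_polys :: "nat \<Rightarrow> 'a::field poly set" where
  "short_unit_polys m = {P. poly P 0 = 1 \<and> degree P < m}"

lemma finite_unit_polys: "finite (unit_polys m :: 'a::{field,finite} poly set)"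
proof -
  have "unit_polys m \<subseteq> Poly ` {xs :: 'a list. set xs \<subseteq> UNIV \<and> length xs = Suc m}"
  proof
    fix P :: "'a poly" assume "P \<in> unit_polys m"
    hence "P \<noteq> 0" "degree P = m" by (auto simp: unit_polys_def)
    hence "length (coeffs P) = Suc m" by (simp add: length_coeffs_degree)
    thus "P \<in> Poly ` {xs. set xs \<subseteq> UNIV \<and> length xs = Suc m}"
      by (intro image_eqI[of _ _ "coeffs P"]) auto
  qed
  thus ?thesis by (rule finite_subset) (intro finite_imageI finite_lists_length_eq, simp)
qed

lemma unit_polys_0: "unit_polys 0 = {1}"
  unfolding unit_polys_def by (auto elim!: degree_eq_zeroE simp: one_pCons)

lemma short_unit_polys_1: "short_unit_polys 1 = {1}"
  using unit_polys_0 by (simp add: short_unit_polys_def unit_polys_def)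

lemma bij_betw_mult_unit_polys:
  assumes "C \<in> unit_polys k" "k \<le> m"
  shows "bij_betw (\<lambda>Q. C * Q) (unit_polys (m - k)) {P \<in> unit_polys m. C dvd P}"
proof (rule bij_betw_imageI)
  have C_unit: "C \<noteq> 0" "poly C 0 = 1" "degree C = k" using assms by (auto simp: unit_polys_def)
  show "inj_on (\<lambda>Q. C * Q) (unit_polys (m - k))" using C_unit by (auto simp: inj_on_def)
  have "C * Q \<in> unit_polys m \<longleftrightarrow> Q \<in> unit_polys (m - k)" for Q
    using C_unit assms(2) by (cases "Q = 0") (auto simp: unit_polys_def degree_mult_eq)
  thus "(\<lambda>Q. C * Q) ` unit_polys (m - k) = {P \<in> unit_polys m. C dvd P}"
    by (auto elim!: dvdE)
qed

lemma bij_betw_add_monom_unit_polys: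
  assumes "m > 0"
  shows "bij_betw (\<lambda>(A, c :: 'a::field). A + monom (- c) m)
    (short_unit_polys m \<times> (UNIV - {0})) (unit_polys m)"
proof (rule bij_betw_byWitness[where f' = "\<lambda>P. (P - monom (coeff P m) m, - coeff P m)"])
  have degree_less: "degree (P - monom (coeff P m) m) < m"
    if "P \<in> unit_polys m" for P :: "'a poly"
    using assms that by (intro degree_lessI) (auto simp: coeff_eq_0 unit_polys_def)
  show "(\<lambda>P :: 'a poly. (P - monom (coeff P m) m, - coeff P m)) ` unit_polys m
    \<subseteq> short_unit_polys m \<times> (UNIV - {0})"
  proof (intro image_subsetI)
    fix P :: "'a poly" assume P_unit: "P \<in> unit_polys m"
    hence "coeff P m \<noteq> 0" using assms by (auto simp: unit_polys_def)
    thus "(P - monom (coeff P m) m, - coeff P m) \<in> short_unit_polys m \<times> (UNIV - {0})"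
      using assms P_unit degree_less[OF P_unit]
      by (simp add: unit_polys_def short_unit_polys_def poly_monom power_0_left)
  qed
  show "(\<lambda>(A, c :: 'a). A + monom (- c) m) ` (short_unit_polys m \<times> (UNIV - {0})) \<subseteq> unit_polys m"
    using assms
    by (auto simp: unit_polys_def short_unit_polys_def poly_monom power_0_left degree_monom_eq
        degree_add_eq_right)
qed (auto simp: unit_polys_def short_unit_polys_def coeff_eq_0 minus_monom)

lemma norm_poly_in_unit_polys:
  assumes "b \<in> fixed_units k"
  shows "norm_poly k b \<in> unit_polys k"
proof -
  have fixed: "b \<noteq> 0" "frob k b = b" using assms by (auto simp: fixed_units_def)
  have "degree (norm_poly k b) = k"
    using degree_conj_poly[OF fixed(1), of k]
    by (simp add: to_ac.degree_map_poly_hom flip: map_poly_to_ac_norm_poly[OF fixed(2)])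
  moreover have "to_ac (poly (norm_poly k b) 0) = 1"
    using to_ac.poly_map_poly_hom[of "norm_poly k b" 0]
    by (simp add: map_poly_to_ac_norm_poly[OF fixed(2)] poly_conj_poly_0)
  hence "poly (norm_poly k b) 0 = 1" by (metis to_ac_1 to_ac_eq_iff)
  ultimately show ?thesis by (simp add: unit_polys_def)
qed

lemma card_norm_poly_divisors:
  fixes P :: "'a::{field,finite} poly"
  assumes P_unit: "P \<in> unit_polys m"
  shows "(\<Sum>k=1..m. card {b \<in> fixed_units k. norm_poly k b dvd P}) = m"
proof -
  let ?Q = "map_poly to_ac P"
  define R where "R = {x. poly ?Q x = 0}"
  define S where "S b = {k. k > 0 \<and> frob k b = b \<and> conj_poly k b dvd ?Q}" for b
  have P_nonzero: "P \<noteq> 0" and Q_nonzero: "?Q \<noteq> 0" and degree_Q: "degree ?Q = m"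
    using P_unit
    by (auto simp: unit_polys_def to_ac.map_poly_hom_eq_0_iff to_ac.degree_map_poly_hom)
  have "poly ?Q 0 = 1"
    using P_unit to_ac.poly_map_poly_hom[of P 0] by (simp add: unit_polys_def)
  hence zero_notin_R: "0 \<notin> R" by (simp add: R_def)
  have finite_R: "finite R" unfolding R_def by (rule poly_roots_finite[OF Q_nonzero])
  have period_le: "k \<le> m" if "conj_poly k b dvd ?Q" "b \<noteq> 0" for k b
    using conj_poly_dvd_imp_le_degree[OF that Q_nonzero] degree_Q by simp
  have period_inverse_le: "k \<le> m" if "conj_poly k (inverse x) dvd ?Q" "x \<in> R" for k x
    using that zero_notin_R by (intro period_le) auto
  have card_S: "finite (S (inverse x))" "card (S (inverse x)) = order x ?Q" if "x \<in> R" for x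
    using that zero_notin_R card_conj_poly_dvd[OF P_nonzero, of "inverse x"] unfolding S_def
    by auto
  have inverse_root: "inverse b \<in> R" if "conj_poly k b dvd ?Q" "b \<noteq> 0" "k > 0" for k b
    using conj_poly_dvd_imp_root[OF that] by (simp add: R_def)
  have "bij_betw (\<lambda>(k, b). (inverse b, k))
      (SIGMA k:{1..m}. {b \<in> fixed_units k. norm_poly k b dvd P}) (SIGMA x:R. S (inverse x))"
    by (rule bij_betw_byWitness[where f' = "\<lambda>(x, k). (k, inverse x)"])
       (use zero_notin_R inverse_root period_le period_inverse_le in
         \<open>auto simp: S_def fixed_units_def norm_poly_dvd_iff\<close>)
  hence "card (SIGMA k:{1..m}. {b \<in> fixed_units k. norm_poly k b dvd P})
      = card (SIGMA x:R. S (inverse x))"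
    by (rule bij_betw_same_card)
  also have "\<dots> = (\<Sum>x\<in>R. order x ?Q)"
    using finite_R card_S by (subst card_SigmaI) auto
  also have "\<dots> = m"
    unfolding R_def using sum_order_eq_degree[OF Q_nonzero] degree_Q by simp
  finally show ?thesis by (subst (asm) card_SigmaI) (auto simp: finite_fixed_units)
qed

definition L_series :: "('a::{field,finite} poly \<Rightarrow> 'b::field) \<Rightarrow> 'b fps" where
  "L_series \<Phi> = Abs_fps (\<lambda>m. \<Sum>P\<in>unit_polys m. \<Phi> P)"

definition multiplicative_weight :: "('a::field poly \<Rightarrow> 'b::field) \<Rightarrow> bool" where
  "multiplicative_weight \<Phi> \<longleftrightarrow> \<Phi> 1 = 1 \<and>
    (\<forall>P Q. poly P 0 = 1 \<longrightarrow> poly Q 0 = 1 \<longrightarrow> \<Phi> (P * Q) = \<Phi> P * \<Phi> Q)"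

lemma sum_multiples_unit_polys:
  assumes multiplicative: "multiplicative_weight \<Phi>" and C_unit: "C \<in> unit_polys k"
    and k_le_m: "k \<le> m"
  shows "(\<Sum>P | P \<in> unit_polys m \<and> C dvd P. \<Phi> P) = \<Phi> C * (\<Sum>Q\<in>unit_polys (m - k). \<Phi> Q)"
proof -
  have "(\<Sum>P | P \<in> unit_polys m \<and> C dvd P. \<Phi> P) = (\<Sum>Q\<in>unit_polys (m - k). \<Phi> (C * Q))"
    by (rule sum.reindex_bij_betw[OF bij_betw_mult_unit_polys[OF C_unit k_le_m], symmetric])
  also have "\<dots> = (\<Sum>Q\<in>unit_polys (m - k). \<Phi> C * \<Phi> Q)"
    using multiplicative C_unit
    by (intro sum.cong refl) (simp add: multiplicative_weight_def unit_polys_def)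
  finally show ?thesis by (simp add: sum_distrib_left)
qed

text \<open>A polynomial of degree \<open>m\<close> is counted once for each of its \<open>m\<close> divisors \<open>norm_poly k b\<close>.\<close>

lemma degree_mult_sum_unit_polys:
  fixes \<Phi> :: "'a::{field,finite} poly \<Rightarrow> 'b::field"
  assumes multiplicative: "multiplicative_weight \<Phi>"
  shows "of_nat m * (\<Sum>P\<in>unit_polys m. \<Phi> P)
    = (\<Sum>k=1..m. (\<Sum>b\<in>fixed_units k. \<Phi> (norm_poly k b)) * (\<Sum>Q\<in>unit_polys (m - k). \<Phi> Q))"
proof -
  have "of_nat m * (\<Sum>P\<in>unit_polys m. \<Phi> P)
      = (\<Sum>P\<in>unit_polys m. of_nat (\<Sum>k=1..m. card {b \<in> fixed_units k. norm_poly k b dvd P}) * \<Phi> P)"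
    unfolding sum_distrib_left by (intro sum.cong[OF refl]) (simp only: card_norm_poly_divisors)
  also have "\<dots> = (\<Sum>P\<in>unit_polys m. \<Sum>k=1..m.
      \<Sum>b\<in>fixed_units k. if norm_poly k b dvd P then \<Phi> P else 0)"
  proof (rule sum.cong[OF refl])
    fix P :: "'a poly"
    have "of_nat (card {b \<in> fixed_units k. norm_poly k b dvd P}) * \<Phi> P
        = (\<Sum>b\<in>fixed_units k. if norm_poly k b dvd P then \<Phi> P else 0)" if "k \<ge> 1" for k
      using that finite_fixed_units[of k, where 'a='a]
      by (simp flip: sum.inter_filter)
    thus "of_nat (\<Sum>k=1..m. card {b \<in> fixed_units k. norm_poly k b dvd P}) * \<Phi> P
        = (\<Sum>k=1..m. \<Sum>b\<in>fixed_units k. if norm_poly k b dvd P then \<Phi> P else 0)"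
      by (simp add: sum_distrib_right)
  qed
  also have "\<dots> = (\<Sum>k=1..m. \<Sum>b\<in>fixed_units k.
      \<Sum>P\<in>unit_polys m. if norm_poly k b dvd P then \<Phi> P else 0)"
    by (subst sum.swap, intro sum.cong refl, subst sum.swap, rule refl)
  also have "\<dots> = (\<Sum>k=1..m. \<Sum>b\<in>fixed_units k. \<Phi> (norm_poly k b) *
      (\<Sum>Q\<in>unit_polys (m - k). \<Phi> Q))"
  proof (intro sum.cong refl)
    fix k and b :: "'a alg_closure" assume "k \<in> {1..m}" "b \<in> fixed_units k"
    thus "(\<Sum>P\<in>unit_polys m. if norm_poly k b dvd P then \<Phi> P else 0)
        = \<Phi> (norm_poly k b) * (\<Sum>Q\<in>unit_polys (m - k). \<Phi> Q)"
      unfolding sum.inter_filter[OF finite_unit_polys, symmetric]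
      by (intro sum_multiples_unit_polys[OF multiplicative] norm_poly_in_unit_polys) auto
  qed
  finally show ?thesis by (simp add: sum_distrib_right)
qed

lemma L_series_nth_0: "multiplicative_weight \<Phi> \<Longrightarrow> fps_nth (L_series \<Phi>) 0 = 1"
  by (simp add: L_series_def unit_polys_0 multiplicative_weight_def)

lemma log_deriv_L_series:
  fixes \<Phi> :: "'a::{field,finite} poly \<Rightarrow> 'b::field"
  assumes multiplicative: "multiplicative_weight \<Phi>"
  shows "log_deriv (L_series \<Phi>)
    = Abs_fps (\<lambda>k. if k = 0 then 0 else \<Sum>b\<in>fixed_units k. \<Phi> (norm_poly k b))"
proof (rule log_deriv_eqI)
  let ?A = "L_series \<Phi>"
  let ?L = "Abs_fps (\<lambda>k. if k = 0 then 0 else \<Sum>b\<in>fixed_units k. \<Phi> (norm_poly k b))"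
  show "fps_nth ?A 0 \<noteq> 0" using L_series_nth_0[OF multiplicative] by simp
  show "fps_X * fps_deriv ?A = ?A * ?L"
  proof (rule fps_ext)
    fix m
    have "fps_nth (fps_X * fps_deriv ?A) m = of_nat m * fps_nth ?A m"
      by (cases m) auto
    also have "\<dots> = (\<Sum>k=1..m. fps_nth ?L k * fps_nth ?A (m - k))"
      using degree_mult_sum_unit_polys[OF multiplicative, of m] by (simp add: L_series_def)
    also have "\<dots> = (\<Sum>k=0..m. fps_nth ?L k * fps_nth ?A (m - k))"
      by (simp add: sum.atLeast_Suc_atMost[of 0 m])
    also have "\<dots> = fps_nth (?A * ?L) m" by (simp add: fps_mult_nth mult.commute[of ?A])
    finally show "fps_nth (fps_X * fps_deriv ?A) m = fps_nth (?A * ?L) m" .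
  qed
qed

section \<open>Norms and power fibres\<close>

definition poly_norm :: "'a::field poly \<Rightarrow> 'a" where
  "poly_norm P = (-1) ^ degree P * lead_coeff P"

definition field_norm :: "nat \<Rightarrow> 'a::{field,finite} alg_closure \<Rightarrow> 'a" where
  "field_norm k b = poly_norm (norm_poly k b)"

lemma poly_norm_1: "poly_norm 1 = 1"
  by (simp add: poly_norm_def)

lemma poly_norm_mult:
  fixes P Q :: "'a::field poly"
  assumes "P \<noteq> 0" "Q \<noteq> 0"
  shows "poly_norm (P * Q) = poly_norm P * poly_norm Q"
  unfolding poly_norm_def lead_coeff_mult unfolding degree_mult_eq[OF assms] power_add
  by (simp only: mult_ac)

lemma to_ac_field_norm:
  assumes "b \<in> fixed_units k"
  shows "to_ac (field_norm k b) = (\<Prod>j<k. frob j b)"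
proof -
  have fixed: "b \<noteq> 0" "frob k b = b" using assms by (auto simp: fixed_units_def)
  have "to_ac (field_norm k b) = (-1) ^ k * lead_coeff (conj_poly k b)"
    using norm_poly_in_unit_polys[OF assms]
    by (simp add: field_norm_def poly_norm_def unit_polys_def degree_conj_poly[OF fixed(1)]
        coeff_map_poly to_ac.degree_map_poly_hom flip: map_poly_to_ac_norm_poly[OF fixed(2)])
  also have "\<dots> = (-1) ^ k * (\<Prod>j<k. - frob j b)"
    unfolding conj_poly_def lead_coeff_prod using fixed(1) by (simp add: frob.hom_eq_0_iff)
  also have "\<dots> = (\<Prod>j<k. frob j b)"
    by (simp add: prod_uminus flip: mult.assoc power_mult_distrib)
  finally show ?thesis .
qed

lemma field_norm_nonzero: "b \<in> fixed_units k \<Longrightarrow> field_norm k b \<noteq> 0"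
  using to_ac_field_norm[of b k] by (auto simp: fixed_units_def frob.hom_eq_0_iff)

lemma field_norm_power:
  assumes "b \<in> fixed_units k"
  shows "field_norm k (b ^ n) = field_norm k b ^ n"
proof -
  have "to_ac (field_norm k (b ^ n)) = to_ac (field_norm k b ^ n)"
    using assms
    by (simp add: to_ac_field_norm power_fixed_units frob.hom_power prod_power_distrib)
  thus ?thesis unfolding to_ac_eq_iff .
qed

lemma power_sum_norm_poly:
  assumes "b \<in> fixed_units k" "n > 0"
  shows "to_ac (power_sum n (norm_poly k b)) = (\<Sum>j<k. frob j b ^ n)"
proof -
  have "to_ac (power_sum n (norm_poly k b)) = power_sum n (conj_poly k b)"
    using assms(1) norm_poly_in_unit_polys[OF assms(1)]
    by (simp add: unit_polys_def fixed_units_def map_poly_to_ac_norm_poly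
        flip: to_ac.power_sum_map_poly_hom)
  thus ?thesis by (simp add: conj_poly_def power_sum_prod_linear[OF assms(2)])
qed

lemma to_ac_field_norm_eq_power:
  fixes y :: "'a::{field,finite} alg_closure"
  assumes "y \<in> fixed_units k"
  shows "to_ac (field_norm k y) = y ^ (\<Sum>j<k. CARD('a) ^ j)"
  by (simp add: to_ac_field_norm[OF assms] frob_def power_sum)

context residue_characters
begin

lemma nth_root_in_fixed_units:
  fixes b :: "'a alg_closure"
  assumes power_fixed: "b ^ d \<in> fixed_units k" and norm_power: "field_norm k (b ^ d) ^ t = 1"
  shows "b \<in> fixed_units k"
proof -
  define E where "E = (\<Sum>j<k. CARD('a) ^ j)"
  have "(\<Sum>j<k. Suc u ^ j) * u + 1 = Suc u ^ k" for u :: nat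
    by (induction k) (simp_all add: algebra_simps)
  from this[of "CARD('a) - 1"] have "E * (d * t) + 1 = CARD('a) ^ k"
    using card_field_ge_2[where 'a='a] by (simp add: E_def index)
  hence "frob k b = (b ^ d) ^ (E * t) * b"
    by (simp add: frob_def mult_ac flip: power_mult power_Suc2 power_Suc)
  also have "(b ^ d) ^ (E * t) = to_ac (field_norm k (b ^ d) ^ t)"
    by (simp add: to_ac_field_norm_eq_power[OF power_fixed] E_def power_mult)
  finally have "frob k b = b" by (simp add: norm_power)
  moreover have "b \<noteq> 0" using power_fixed d_pos by (auto simp: fixed_units_def power_0_left)
  ultimately show ?thesis by (simp add: fixed_units_def)
qed

lemma card_power_fibre:
  fixes y :: "'a alg_closure"
  assumes fixed: "y \<in> fixed_units k"
  shows "card {b \<in> fixed_units k. b ^ d = y} = (if field_norm k y ^ t = 1 then d else 0)"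
proof (cases "field_norm k y ^ t = 1")
  case True
  hence "{b \<in> fixed_units k. b ^ d = y} = {b. b ^ d = y}"
    using fixed by (auto intro: nth_root_in_fixed_units)
  moreover have "of_nat d \<noteq> (0 :: 'a alg_closure)"
    using of_nat_d_nonzero by (metis to_ac_eq_0_iff to_ac_of_nat)
  ultimately show ?thesis
    using fixed True card_nth_roots_alg_closed[of y d] by (simp add: fixed_units_def)
next
  case False
  have "field_norm k (b ^ d) ^ t = 1" if "b \<in> fixed_units k" for b :: "'a alg_closure"
    using field_power_card_minus_1[OF field_norm_nonzero[OF that]]
    by (simp add: field_norm_power[OF that] index flip: power_mult)
  hence empty: "{b \<in> fixed_units k. b ^ d = y} = {}" using False by blast
  show ?thesis unfolding empty using False by simp
qed

lemma card_power_fibre_eq_char_sum: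
  fixes y :: "'a alg_closure"
  assumes "y \<in> fixed_units k"
  shows "of_nat (card {b \<in> fixed_units k. b ^ d = y})
    = (\<Sum>i<d. char_pow T (i * t) (field_norm k y))"
  using sum_char_pow_mult_t[OF field_norm_nonzero[OF assms]]
  by (simp add: card_power_fibre[OF assms])

lemma sum_power_fixed_units:
  fixes h :: "'a alg_closure \<Rightarrow> complex"
  assumes "k > 0"
  shows "(\<Sum>b\<in>fixed_units k. h (b ^ d))
    = (\<Sum>i<d. \<Sum>y\<in>fixed_units k. char_pow T (i * t) (field_norm k y) * h y)"
proof -
  let ?K = "fixed_units k"
  have "(\<Sum>b\<in>?K. h (b ^ d)) = (\<Sum>y\<in>?K. \<Sum>b\<in>{b \<in> ?K. b ^ d = y}. h (b ^ d))"
    using finite_fixed_units[OF assms]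
    by (intro sum.group[symmetric]) (auto simp: power_fixed_units)
  also have "\<dots> = (\<Sum>y\<in>?K. of_nat (card {b \<in> ?K. b ^ d = y}) * h y)"
    by (intro sum.cong refl) simp
  also have "\<dots> = (\<Sum>y\<in>?K. \<Sum>i<d. char_pow T (i * t) (field_norm k y) * h y)"
    by (intro sum.cong refl) (simp only: card_power_fibre_eq_char_sum sum_distrib_right)
  finally show ?thesis by (subst sum.swap)
qed

lemma sum_power_eq_char_sum:
  "(\<Sum>x\<in>UNIV - {0}. h (x ^ d)) = (\<Sum>i<d. \<Sum>y\<in>UNIV. char_pow T (i * t) y * h y)"
proof -
  have field_norm_to_ac: "field_norm 1 (to_ac y) = y" if "y \<noteq> 0" for y :: 'a
  proof -
    have "to_ac y \<in> fixed_units 1" using that by (simp only: fixed_units_1) blast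
    thus ?thesis using to_ac_field_norm[of "to_ac y" 1] by simp
  qed
  have sum_units: "(\<Sum>b\<in>fixed_units 1. f b) = (\<Sum>x\<in>UNIV - {0}. f (to_ac (x :: 'a)))"
    for f :: "'a alg_closure \<Rightarrow> complex"
    unfolding fixed_units_1 by (rule sum.reindex_cong[of to_ac]) (auto simp: inj_on_def)
  have "(\<Sum>x\<in>UNIV - {0}. h (x ^ d)) = (\<Sum>b\<in>fixed_units 1. h (of_ac (b ^ d)))"
    unfolding sum_units by (simp flip: to_ac_power)
  also have "\<dots> = (\<Sum>i<d. \<Sum>y\<in>UNIV - {0}. char_pow T (i * t) y * h y)"
    unfolding sum_power_fixed_units[of 1 "\<lambda>b. h (of_ac b)", OF zero_less_one] sum_units
    by (intro sum.cong refl) (auto simp: field_norm_to_ac simp del: One_nat_def)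
  also have "\<dots> = (\<Sum>i<d. \<Sum>y\<in>UNIV. char_pow T (i * t) y * h y)"
    by (intro sum.cong refl sum.mono_neutral_left) (auto simp: char_pow_def)
  finally show ?thesis .
qed

end

section \<open>The Hasse--Davenport product formula\<close>

context additive_character
begin

definition poly_weight :: "nat \<Rightarrow> ('a \<Rightarrow> complex) \<Rightarrow> 'a poly \<Rightarrow> complex" where
  "poly_weight n \<chi> P = \<chi> (poly_norm P) ^ n * \<theta> (power_sum n P)"

lemma multiplicative_poly_weight:
  assumes "is_mchar \<chi>"
  shows "multiplicative_weight (poly_weight n \<chi>)"
proof -
  have "poly_weight n \<chi> (P * Q) = poly_weight n \<chi> P * poly_weight n \<chi> Q"
    if "poly P 0 = 1" "poly Q 0 = 1" for P Q
  proof -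
    have "P \<noteq> 0" "Q \<noteq> 0" using that by auto
    thus ?thesis
      by (simp add: poly_weight_def poly_norm_mult power_sum_mult[OF that] mchar_mult[OF assms]
          theta_add power_mult_distrib mult_ac)
  qed
  moreover have "poly_weight n \<chi> 1 = 1"
    by (simp add: poly_weight_def poly_norm_1 power_sum_1 mchar_1[OF assms] theta_0)
  ultimately show ?thesis by (simp add: multiplicative_weight_def)
qed

lemma poly_weight_norm_poly:
  assumes mchar: "is_mchar \<chi>" and fixed: "b \<in> fixed_units k" and n_pos: "n > 0"
  shows "poly_weight n \<chi> (norm_poly k b) = poly_weight 1 \<chi> (norm_poly k (b ^ n))"
proof -
  have "to_ac (power_sum n (norm_poly k b)) = to_ac (power_sum 1 (norm_poly k (b ^ n)))"
    by (simp add: power_sum_norm_poly power_fixed_units fixed n_pos frob.hom_power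
        del: to_ac_eq_iff)
  moreover have "\<chi> (poly_norm (norm_poly k (b ^ n))) = \<chi> (poly_norm (norm_poly k b)) ^ n"
    using field_norm_power[OF fixed] by (simp add: field_norm_def mchar_power[OF mchar])
  ultimately show ?thesis by (simp add: poly_weight_def)
qed

lemma poly_weight_add_monom:
  assumes mchar: "is_mchar \<chi>" and A_short: "A \<in> short_unit_polys n" and c_nonzero: "c \<noteq> 0"
    and n_pos: "n > 0"
  shows "poly_weight n \<chi> (A + monom (- c) n)
    = \<theta> (power_sum n A) * (char_pow \<chi> n c * \<theta> (of_nat n * c))"
proof -
  have "degree (A + monom (- c) n) = n" "coeff (A + monom (- c) n) n = - c"
    using A_short c_nonzero degree_add_eq_right[of A "monom (- c) n"]
    by (simp_all add: short_unit_polys_def degree_monom_eq coeff_eq_0)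
  hence "poly_norm (A + monom (- c) n) ^ n = ((-1) ^ n) ^ n * (- c) ^ n"
    by (simp add: poly_norm_def flip: power_mult_distrib)
  also have "\<dots> = ((-1) ^ (n * n + n)) * c ^ n"
    by (simp add: power_add power_mult power_minus[of c])
  also have "\<dots> = c ^ n" by simp
  finally have "\<chi> (poly_norm (A + monom (- c) n)) ^ n = \<chi> c ^ n"
    by (simp flip: mchar_power[OF mchar])
  moreover have "power_sum n (A + monom (- c) n) = power_sum n A + of_nat n * c"
    using A_short n_pos by (simp add: short_unit_polys_def power_sum_add_monom)
  ultimately show ?thesis using c_nonzero by (simp add: poly_weight_def char_pow_def theta_add)
qed

lemma sum_poly_weight_unit_polys:
  assumes mchar: "is_mchar \<chi>" and n_nonzero: "of_nat n \<noteq> (0 :: 'a)"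
  shows "(\<Sum>P\<in>unit_polys n. poly_weight n \<chi> P)
    = (\<Sum>A\<in>short_unit_polys n. \<theta> (power_sum n A))
      * (cnj (\<chi> (of_nat n)) ^ n * gauss (char_pow \<chi> n))"
proof -
  have n_pos: "n > 0" using n_nonzero by (intro gr0I) auto
  have "(\<Sum>P\<in>unit_polys n. poly_weight n \<chi> P)
      = (\<Sum>(A, c)\<in>short_unit_polys n \<times> (UNIV - {0}). poly_weight n \<chi> (A + monom (- c) n))"
    by (simp add: case_prod_unfold
        flip: sum.reindex_bij_betw[OF bij_betw_add_monom_unit_polys[OF n_pos]])
  also have "\<dots> = (\<Sum>(A, c)\<in>short_unit_polys n \<times> (UNIV - {0}).
      \<theta> (power_sum n A) * (char_pow \<chi> n c * \<theta> (of_nat n * c)))"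
    by (intro sum.cong refl)
       (simp add: poly_weight_add_monom[OF mchar _ _ n_pos] split_beta mem_Times_iff)
  also have "\<dots> = (\<Sum>A\<in>short_unit_polys n. \<theta> (power_sum n A))
      * (\<Sum>c\<in>UNIV - {0}. char_pow \<chi> n c * \<theta> (of_nat n * c))"
    by (simp add: sum_product sum.cartesian_product)
  also have "(\<Sum>c\<in>UNIV - {0}. char_pow \<chi> n c * \<theta> (of_nat n * c))
      = (\<Sum>c\<in>UNIV. char_pow \<chi> n c * \<theta> (of_nat n * c))"
    by (rule sum.mono_neutral_left) (auto simp: char_pow_def)
  also have "\<dots> = cnj (\<chi> (of_nat n)) ^ n * gauss (char_pow \<chi> n)"
    unfolding sum_mchar_theta_mult[OF is_mchar_char_pow[OF mchar] n_nonzero]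
    using n_nonzero by (simp add: char_pow_def[of \<chi> n "of_nat n"])
  finally show ?thesis .
qed

lemma sum_poly_weight_1_eq_0:
  assumes m_ge_2: "m \<ge> 2"
  shows "(\<Sum>P\<in>unit_polys m. poly_weight 1 \<chi> P) = 0"
proof -
  obtain a where theta_a: "\<theta> a \<noteq> 1" using theta_nontrivial by blast
  have degree_shift: "degree (P + monom c 1) = m"
    and coeff_shift: "coeff (P + monom c 1) m = coeff P m"
    if "degree P = m" for P and c :: 'a
    using that m_ge_2 degree_monom_le[of c 1] degree_add_eq_left[of "monom c 1" P] by auto
  have shift_unit: "P + monom c 1 \<in> unit_polys m" if "P \<in> unit_polys m" for P and c :: 'a
    using that degree_shift by (simp add: unit_polys_def poly_monom)
  have "monom a 1 + monom (- a) 1 = 0" "monom (- a) 1 + monom a 1 = 0"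
    by (simp_all add: add_monom)
  hence "(\<Sum>P\<in>unit_polys m. poly_weight 1 \<chi> P)
      = (\<Sum>P\<in>unit_polys m. poly_weight 1 \<chi> (P + monom (- a) 1))"
    using shift_unit
    by (intro sum.reindex_bij_witness[of _ "\<lambda>P. P + monom (- a) 1" "\<lambda>P. P + monom a 1"])
       (auto simp: add.assoc)
  also have "\<dots> = (\<Sum>P\<in>unit_polys m. \<theta> a * poly_weight 1 \<chi> P)"
  proof (rule sum.cong[OF refl])
    fix P :: "'a poly" assume P_unit: "P \<in> unit_polys m"
    hence "poly_norm (P + monom (- a) 1) = poly_norm P"
      using degree_shift[of P "-a"] coeff_shift[of P "-a"]
      by (simp add: poly_norm_def unit_polys_def)
    moreover have "power_sum 1 (P + monom (- a) 1) = a + power_sum 1 P"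
      using P_unit power_sum_add_monom[of P 1 "- a"] by (simp add: unit_polys_def)
    ultimately show "poly_weight 1 \<chi> (P + monom (- a) 1) = \<theta> a * poly_weight 1 \<chi> P"
      by (simp add: poly_weight_def theta_add)
  qed
  finally show ?thesis using theta_a by (simp flip: sum_distrib_left)
qed

lemma L_series_poly_weight_1:
  assumes mchar: "is_mchar \<chi>"
  shows "L_series (poly_weight 1 \<chi>) = fps_of_poly [:1, gauss \<chi>:]"
proof (rule fps_ext)
  fix m :: nat
  have "char_pow \<chi> 1 = \<chi>" using mchar_0[OF mchar] by (auto simp: char_pow_def)
  hence sum_1: "(\<Sum>P\<in>unit_polys 1. poly_weight 1 \<chi> P) = gauss \<chi>"
    using sum_poly_weight_unit_polys[OF mchar, of 1]
    by (simp add: short_unit_polys_1 power_sum_1 theta_0 mchar_1[OF mchar] del: One_nat_def)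
  consider (zero) "m = 0" | (one) "m = 1" | (large) "m \<ge> 2" by linarith
  thus "fps_nth (L_series (poly_weight 1 \<chi>)) m = fps_nth (fps_of_poly [:1, gauss \<chi>:]) m"
  proof cases
    case zero
    thus ?thesis by (simp add: L_series_nth_0[OF multiplicative_poly_weight[OF mchar]])
  next
    case one
    thus ?thesis using sum_1 by (simp add: L_series_def)
  next
    case large
    hence "degree [:1, gauss \<chi>:] < m" by (auto simp: degree_pCons_eq_if)
    thus ?thesis using sum_poly_weight_1_eq_0[OF large] by (simp add: L_series_def coeff_eq_0)
  qed
qed

end

locale residue_gauss_sums = additive_character \<theta> + residue_characters T d t
  for \<theta> T :: "'a::{field,finite} \<Rightarrow> complex" and d t :: nat
begin

lemma log_deriv_L_series_poly_weight:
  assumes mchar: "is_mchar \<chi>"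
  shows "log_deriv (L_series (poly_weight d \<chi>))
    = (\<Sum>i<d. log_deriv (L_series (poly_weight 1 (char_mult \<chi> (char_pow T (i * t))))))"
proof -
  let ?w = "\<lambda>i. poly_weight 1 (char_mult \<chi> (char_pow T (i * t)))"
  have "(\<Sum>b\<in>fixed_units k. poly_weight d \<chi> (norm_poly k b))
      = (\<Sum>i<d. \<Sum>y\<in>fixed_units k. ?w i (norm_poly k y))" if "k > 0" for k
  proof -
    have "(\<Sum>b\<in>fixed_units k. poly_weight d \<chi> (norm_poly k b))
        = (\<Sum>b\<in>fixed_units k. poly_weight 1 \<chi> (norm_poly k (b ^ d)))"
      by (intro sum.cong refl poly_weight_norm_poly mchar d_pos)
    also have "\<dots> = (\<Sum>i<d. \<Sum>y\<in>fixed_units k. char_pow T (i * t) (field_norm k y)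
        * poly_weight 1 \<chi> (norm_poly k y))"
      by (rule sum_power_fixed_units[OF that])
    finally show ?thesis
      by (simp add: poly_weight_def char_mult_def field_norm_def mult_ac)
  qed
  moreover have "multiplicative_weight (?w i)" for i
    using mchar is_mchar_char_pow_T by (intro multiplicative_poly_weight) auto
  ultimately show ?thesis
    by (intro fps_ext)
       (simp add: log_deriv_L_series multiplicative_poly_weight[OF mchar] fps_sum_nth)
qed

lemma L_series_poly_weight:
  assumes mchar: "is_mchar \<chi>"
  shows "L_series (poly_weight d \<chi>)
    = fps_of_poly (\<Prod>i<d. [:1, gauss (char_mult \<chi> (char_pow T (i * t))):])"
proof -
  let ?w = "\<lambda>i. poly_weight 1 (char_mult \<chi> (char_pow T (i * t)))"
  have mchar_twist: "is_mchar (char_mult \<chi> (char_pow T (i * t)))" for i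
    using mchar is_mchar_char_pow_T by auto
  note nth_0 = L_series_nth_0[OF multiplicative_poly_weight[OF mchar_twist]]
    L_series_nth_0[OF multiplicative_poly_weight[OF mchar]]
  have "L_series (poly_weight d \<chi>) = (\<Prod>i<d. L_series (?w i))"
  proof (rule log_deriv_eq_imp_eq)
    show "log_deriv (L_series (poly_weight d \<chi>)) = log_deriv (\<Prod>i<d. L_series (?w i))"
      by (simp add: log_deriv_L_series_poly_weight[OF mchar] log_deriv_prod nth_0)
  qed (simp_all add: fps_nth_0_prod nth_0)
  thus ?thesis by (simp only: L_series_poly_weight_1[OF mchar_twist] fps_of_poly_prod)
qed

lemma prod_gauss_char_pow_mult_t:
  assumes mchar: "is_mchar \<chi>"
  shows "(\<Prod>i<d. gauss (char_mult \<chi> (char_pow T (i * t))))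
    = (\<Sum>A\<in>short_unit_polys d. \<theta> (power_sum d A))
      * (cnj (\<chi> (of_nat d)) ^ d * gauss (char_pow \<chi> d))"
proof -
  let ?g = "\<lambda>i. gauss (char_mult \<chi> (char_pow T (i * t)))"
  have gauss_twist_nonzero: "?g i \<noteq> 0" for i
    using mchar is_mchar_char_pow_T by (intro gauss_nonzero) auto
  hence "degree (\<Prod>i<d. [:1, ?g i:]) = d"
    by (subst degree_prod_eq_sum_degree) auto
  hence "(\<Prod>i<d. ?g i) = coeff (\<Prod>i<d. [:1, ?g i:]) d"
    using lead_coeff_prod[of "\<lambda>i. [:1, ?g i:]" "{..<d}"] gauss_twist_nonzero by simp
  also have "\<dots> = fps_nth (L_series (poly_weight d \<chi>)) d"
    by (simp add: L_series_poly_weight[OF mchar])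
  also have "\<dots> = (\<Sum>P\<in>unit_polys d. poly_weight d \<chi> P)"
    by (simp add: L_series_def)
  finally show ?thesis
    by (simp only: sum_poly_weight_unit_polys[OF mchar of_nat_d_nonzero])
qed

theorem hasse_davenport_product:
  assumes mchar: "is_mchar \<chi>"
  shows "(\<Prod>i<d. gauss (char_mult \<chi> (char_pow T (i * t))))
    = cnj (\<chi> (of_nat d)) ^ d * gauss (char_pow \<chi> d) * (\<Prod>i\<in>{1..<d}. gauss (char_pow T (i * t)))"
proof -
  define S where "S = (\<Sum>A\<in>short_unit_polys d. \<theta> (power_sum d A))"
  have "(\<Prod>i<d. gauss (char_pow T (i * t))) = S * gauss triv_char"
    using prod_gauss_char_pow_mult_t[of triv_char] of_nat_d_nonzero
    by (simp add: char_mult_triv_left[OF is_mchar_char_pow_T] triv_char_def[of "of_nat d"] S_def)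
  hence "S = (\<Prod>i\<in>{1..<d}. gauss (char_pow T (i * t)))"
    by (simp add: gauss_triv flip: insert_0_range)
  thus ?thesis using prod_gauss_char_pow_mult_t[OF mchar] by (simp add: S_def)
qed

end

section \<open>Counting points on the affine cone\<close>

definition tuples :: "nat \<Rightarrow> 'b::zero set \<Rightarrow> (nat \<Rightarrow> 'b) set" where
  "tuples d B = {x. (\<forall>i<d. x i \<in> B) \<and> (\<forall>i\<ge>d. x i = 0)}"

lemma bij_betw_PiE_tuples:
  "bij_betw (\<lambda>p i. if i < d then p i else 0) ({..<d} \<rightarrow>\<^sub>E B) (tuples d B)"
proof (rule bij_betw_byWitness[where f' = "\<lambda>x. restrict x {..<d}"])
  show "\<forall>p\<in>{..<d} \<rightarrow>\<^sub>E B. restrict (\<lambda>i. if i < d then p i else 0) {..<d} = p"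
    by (auto simp: fun_eq_iff PiE_def extensional_def)
qed (auto simp: tuples_def fun_eq_iff PiE_def)

lemma finite_tuples: "finite B \<Longrightarrow> finite (tuples d B)"
  using bij_betw_finite[OF bij_betw_PiE_tuples[of d B]] by (simp add: finite_PiE)

lemma card_tuples: "finite B \<Longrightarrow> card (tuples d B) = card B ^ d"
  using bij_betw_same_card[OF bij_betw_PiE_tuples[of d B]] by (simp add: card_PiE)

lemma sum_tuples_prod:
  fixes f :: "'b::zero \<Rightarrow> 'c::comm_semiring_1"
  assumes "finite B"
  shows "(\<Sum>x\<in>tuples d B. \<Prod>i<d. f (x i)) = (\<Sum>y\<in>B. f y) ^ d"
proof -
  have "(\<Sum>x\<in>tuples d B. \<Prod>i<d. f (x i)) = (\<Sum>p\<in>{..<d} \<rightarrow>\<^sub>E B. \<Prod>i<d. f (p i))"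
    unfolding sum.reindex_bij_betw[OF bij_betw_PiE_tuples, symmetric] by simp
  also have "\<dots> = (\<Prod>i<d. \<Sum>y\<in>B. f y)"
    using assms by (subst prod_sum_PiE) auto
  finally show ?thesis by simp
qed

definition punctured_line :: "('i \<Rightarrow> 'a::field) \<Rightarrow> ('i \<Rightarrow> 'a) set" where
  "punctured_line x = {(\<lambda>i. c * x i) | c. c \<noteq> 0}"

lemma self_in_punctured_line: "x \<in> punctured_line x"
  unfolding punctured_line_def by (rule CollectI, rule exI[of _ 1]) auto

lemma punctured_line_eqI:
  assumes "y \<in> punctured_line x"
  shows "punctured_line y = punctured_line x"
proof -
  obtain c where y_eq: "c \<noteq> 0" "y = (\<lambda>i. c * x i)" using assms by (auto simp: punctured_line_def)
  have "(\<lambda>i. e * y i) \<in> punctured_line x" if "e \<noteq> 0" for e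
    unfolding punctured_line_def using that y_eq
    by (intro CollectI exI[of _ "e * c"]) (auto simp: mult.assoc)
  moreover have "(\<lambda>i. e * x i) \<in> punctured_line y" if "e \<noteq> 0" for e
    unfolding punctured_line_def using that y_eq
    by (intro CollectI exI[of _ "e / c"]) (auto simp: mult.assoc)
  ultimately show ?thesis by (auto simp: punctured_line_def)
qed

lemma card_punctured_line:
  fixes x :: "'i \<Rightarrow> 'a::{field,finite}"
  assumes "x i \<noteq> 0"
  shows "card (punctured_line x) = CARD('a) - 1"
proof -
  have "inj_on (\<lambda>c i. c * x i) (UNIV - {0})"
    using assms by (auto simp: inj_on_def fun_eq_iff)
  moreover have "punctured_line x = (\<lambda>c i. c * x i) ` (UNIV - {0})"
    by (auto simp: punctured_line_def)
  ultimately show ?thesis by (simp add: card_image)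
qed

lemma card_cone:
  fixes S :: "('i \<Rightarrow> 'a::{field,finite}) set"
  assumes finite_S: "finite S" and nonzero: "\<And>x. x \<in> S \<Longrightarrow> \<exists>i. x i \<noteq> 0"
    and scale: "\<And>x c. x \<in> S \<Longrightarrow> c \<noteq> 0 \<Longrightarrow> (\<lambda>i. c * x i) \<in> S"
  shows "card S = (CARD('a) - 1) * card (punctured_line ` S)"
proof -
  have "card {x \<in> S. punctured_line x = C} = CARD('a) - 1"
    if C_line: "C \<in> punctured_line ` S" for C
  proof -
    obtain y where y_line: "y \<in> S" "C = punctured_line y" using C_line by blast
    have "punctured_line y \<subseteq> S" using scale[OF y_line(1)] by (auto simp: punctured_line_def)
    hence "{x \<in> S. punctured_line x = C} = punctured_line y"
      using y_line(2) self_in_punctured_line punctured_line_eqI by blast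
    thus ?thesis using nonzero[OF y_line(1)] card_punctured_line by metis
  qed
  moreover have "card S = (\<Sum>C\<in>punctured_line ` S. card {x \<in> S. punctured_line x = C})"
    using sum.image_gen[OF finite_S, of "\<lambda>_. 1::nat" punctured_line] by simp
  ultimately show ?thesis by simp
qed

definition dwork_form :: "nat \<Rightarrow> 'a::field \<Rightarrow> (nat \<Rightarrow> 'a) \<Rightarrow> 'a" where
  "dwork_form d lam x = (\<Sum>i<d. x i ^ d) - of_nat d * lam * (\<Prod>i<d. x i)"

definition dwork_cone :: "nat \<Rightarrow> 'a::field \<Rightarrow> (nat \<Rightarrow> 'a) set" where
  "dwork_cone d lam = {x \<in> tuples d UNIV. dwork_form d lam x = 0}"

lemma card_dwork_cone:
  fixes lam :: "'a::{field,finite}"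
  assumes "d > 0"
  shows "card (dwork_cone d lam) = (CARD('a) - 1) * card (dwork_points d lam) + 1"
proof -
  define S where "S = dwork_cone d lam - {\<lambda>i. 0}"
  have finite_cone: "finite (dwork_cone d lam)" by (simp add: dwork_cone_def finite_tuples)
  have zero_in_cone: "(\<lambda>i. 0) \<in> dwork_cone d lam"
    using assms by (simp add: dwork_cone_def tuples_def dwork_form_def power_0_left)
  have "S = {x. (\<forall>i\<ge>d. x i = 0) \<and> (\<exists>i<d. x i \<noteq> 0) \<and>
      (\<Sum>i<d. x i ^ d) = of_nat d * lam * (\<Prod>i<d. x i)}"
    by (auto simp: S_def dwork_cone_def tuples_def dwork_form_def fun_eq_iff) (metis not_le)+
  hence points: "dwork_points d lam = punctured_line ` S"
    by (simp add: dwork_points_def punctured_line_def)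
  have "card S = (CARD('a) - 1) * card (punctured_line ` S)"
  proof (rule card_cone)
    fix x :: "nat \<Rightarrow> 'a" and c :: 'a assume "x \<in> S" "c \<noteq> 0"
    moreover have "dwork_form d lam (\<lambda>i. c * x i) = c ^ d * dwork_form d lam x"
      by (simp add: dwork_form_def power_mult_distrib prod.distrib algebra_simps sum_distrib_left)
    ultimately show "(\<lambda>i. c * x i) \<in> S"
      by (auto simp: S_def dwork_cone_def tuples_def fun_eq_iff)
  qed (use finite_cone in \<open>auto simp: S_def fun_eq_iff\<close>)
  moreover have "card (dwork_cone d lam) = card S + 1"
    unfolding S_def card.remove[OF finite_cone zero_in_cone] by simp
  ultimately show ?thesis by (simp add: points)
qed

lemma (in additive_character) card_dwork_cone_eq_character_sum:
  "of_nat CARD('a) * of_nat (card (dwork_cone d lam)) = of_nat CARD('a) ^ d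
     + (\<Sum>z\<in>UNIV - {0}. \<Sum>x\<in>tuples d UNIV. \<theta> (dwork_form d lam x * z))"
proof -
  let ?V = "tuples d UNIV :: (nat \<Rightarrow> 'a) set"
  have "of_nat CARD('a) * of_nat (card (dwork_cone d lam))
      = (\<Sum>x | x \<in> ?V \<and> dwork_form d lam x = 0. of_nat CARD('a) :: complex)"
    by (simp add: dwork_cone_def)
  also have "\<dots> = (\<Sum>x\<in>?V. if dwork_form d lam x = 0 then of_nat CARD('a) else 0)"
    by (rule sum.inter_filter) (simp add: finite_tuples)
  also have "\<dots> = (\<Sum>z\<in>UNIV. \<Sum>x\<in>?V. \<theta> (dwork_form d lam x * z))"
    by (subst sum.swap) (simp add: sum_theta)
  also have "\<dots> = (\<Sum>x\<in>?V. \<theta> (dwork_form d lam x * 0))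
      + (\<Sum>z\<in>UNIV - {0}. \<Sum>x\<in>?V. \<theta> (dwork_form d lam x * z))"
    by (rule sum.remove) auto
  also have "(\<Sum>x\<in>?V. \<theta> (dwork_form d lam x * 0)) = of_nat CARD('a) ^ d"
    by (simp add: theta_0 card_tuples)
  finally show ?thesis .
qed

definition Wstar :: "nat \<Rightarrow> (nat \<Rightarrow> nat) set" where
  "Wstar d = {w \<in> Wset d. \<forall>i<d. w i \<noteq> 0}"

lemma Wset_eq_tuples: "d > 0 \<Longrightarrow> Wset d = {w \<in> tuples d {..<d}. d dvd (\<Sum>i<d. w i)}"
  by (auto simp: Wset_def tuples_def mod_eq_0_iff_dvd)

lemma Wstar_eq_tuples: "Wstar d = {w \<in> tuples d {1..<d}. d dvd (\<Sum>i<d. w i)}"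
  by (auto simp: Wstar_def Wset_def tuples_def mod_eq_0_iff_dvd)

lemma finite_Wset: "d > 0 \<Longrightarrow> finite (Wset d)"
  by (simp add: Wset_eq_tuples finite_tuples)

lemma sum_multiples:
  fixes f :: "nat \<Rightarrow> 'b::comm_monoid_add"
  assumes "d > 0" "\<And>m. \<not> d dvd m \<Longrightarrow> f m = 0"
  shows "(\<Sum>m<d * t. f m) = (\<Sum>j<t. f (d * j))"
proof -
  have "(\<Sum>j<t. f (d * j)) = (\<Sum>m\<in>(\<lambda>j. d * j) ` {..<t}. f m)"
    using assms(1) by (subst sum.reindex) (auto simp: inj_on_def)
  also have "\<dots> = (\<Sum>m<d * t. f m)"
    using assms by (intro sum.mono_neutral_left) (auto intro!: assms(2))
  finally show ?thesis by simp
qed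

context residue_gauss_sums
begin

definition monomial_sum :: "('a \<Rightarrow> complex) \<Rightarrow> 'a \<Rightarrow> complex" where
  "monomial_sum \<chi> z = (\<Sum>x\<in>UNIV. \<chi> x * \<theta> (z * x ^ d))"

lemma monomial_sum_char_pow:
  assumes nonzero: "z \<noteq> 0"
  shows "monomial_sum (char_pow T (d * j)) z
    = (\<Sum>i<d. cnj (char_pow T (i * t + j) z) * gauss (char_pow T (i * t + j)))"
proof -
  have "monomial_sum (char_pow T (d * j)) z
      = (\<Sum>x\<in>UNIV - {0}. char_pow T j (x ^ d) * \<theta> (z * x ^ d))"
    unfolding monomial_sum_def
    by (rule sum.mono_neutral_cong_right)
       (auto simp: char_pow_def mchar_power[OF is_mchar_T] power_mult)
  also have "\<dots> = (\<Sum>i<d. \<Sum>y\<in>UNIV. char_pow T (i * t) y * (char_pow T j y * \<theta> (z * y)))"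
    by (rule sum_power_eq_char_sum)
  also have "\<dots> = (\<Sum>i<d. \<Sum>y\<in>UNIV. char_pow T (i * t + j) y * \<theta> (z * y))"
    by (simp add: char_pow_add char_mult_def mult.assoc)
  finally show ?thesis by (simp only: sum_mchar_theta_mult[OF is_mchar_char_pow_T nonzero])
qed

lemma sum_theta_power:
  assumes nonzero: "z \<noteq> 0"
  shows "(\<Sum>x\<in>UNIV. \<theta> (z * x ^ d))
    = (\<Sum>i\<in>{1..<d}. cnj (char_pow T (i * t) z) * gauss (char_pow T (i * t)))"
proof -
  have "(\<Sum>x\<in>UNIV. \<theta> (z * x ^ d)) = 1 + (\<Sum>x\<in>UNIV - {0}. \<theta> (z * x ^ d))"
    using d_pos by (subst sum.remove[of _ 0]) (auto simp: power_0_left theta_0)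
  also have "(\<Sum>x\<in>UNIV - {0}. \<theta> (z * x ^ d)) = monomial_sum triv_char z"
    unfolding monomial_sum_def
    by (rule sum.mono_neutral_cong_left) (auto simp: triv_char_def)
  also have "\<dots> = (\<Sum>i<d. cnj (char_pow T (i * t) z) * gauss (char_pow T (i * t)))"
    using monomial_sum_char_pow[OF nonzero, of 0] by simp
  also have "\<dots> = -1 + (\<Sum>i\<in>{1..<d}. cnj (char_pow T (i * t) z) * gauss (char_pow T (i * t)))"
    using nonzero by (simp add: gauss_triv triv_char_def[of z] flip: insert_0_range)
  finally show ?thesis by simp
qed

lemma monomial_sum_eq_0:
  assumes not_dvd: "\<not> d dvd m"
  shows "monomial_sum (char_pow T m) z = 0"
proof -
  have "char_pow T (m * t) \<noteq> triv_char" using not_dvd by (simp add: char_pow_mult_t_eq_triv_iff)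
  then obtain y where y_nontriv: "y \<noteq> 0" "T y ^ (m * t) \<noteq> 1"
    by (auto simp: fun_eq_iff char_pow_def triv_char_def split: if_splits)
  define v where "v = y ^ t"
  have v_root: "v \<noteq> 0" "v ^ d = 1"
    using y_nontriv field_power_card_minus_1[OF y_nontriv(1)]
    by (simp_all add: v_def index mult.commute[of t d] flip: power_mult)
  have "char_pow T m v \<noteq> 1"
    using y_nontriv v_root(1)
    by (simp add: char_pow_def v_def mchar_power[OF is_mchar_T] mult.commute
        flip: power_mult)
  moreover have "monomial_sum (char_pow T m) z = char_pow T m v * monomial_sum (char_pow T m) z"
  proof -
    have "monomial_sum (char_pow T m) z = (\<Sum>x\<in>UNIV. char_pow T m (v * x) * \<theta> (z * (v * x) ^ d))"
      unfolding monomial_sum_def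
      by (rule sum.reindex_bij_witness[of _ "\<lambda>x. v * x" "\<lambda>x. x / v"]) (use v_root(1) in auto)
    also have "\<dots> = char_pow T m v * monomial_sum (char_pow T m) z"
      by (simp add: monomial_sum_def mchar_mult[OF is_mchar_char_pow_T] power_mult_distrib
          v_root(2) sum_distrib_left mult.assoc)
    finally show ?thesis .
  qed
  ultimately show ?thesis by simp
qed

lemma char_pow_mult_prod_cnj:
  assumes nonzero: "z \<noteq> 0"
  shows "char_pow T (d * j) z * (\<Prod>i<d. cnj (char_pow T (w i * t + j) z))
    = cnj (char_pow T ((\<Sum>i<d. w i) * t) z)"
proof -
  have "T z * cnj (T z) = 1"
    using nonzero by (simp add: mchar_cnj[OF is_mchar_T] mchar_eq_0_iff[OF is_mchar_T])
  hence "T z ^ (d * j) * cnj (T z) ^ (d * j) = 1"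
    by (simp flip: power_mult_distrib)
  moreover have "(\<Prod>i<d. cnj (char_pow T (w i * t + j) z))
      = cnj (T z) ^ (d * j) * cnj (T z) ^ ((\<Sum>i<d. w i) * t)"
    using nonzero
    by (simp add: char_pow_def sum.distrib sum_distrib_right flip: power_sum power_add)
       (simp add: add.commute)
  ultimately show ?thesis using nonzero by (simp add: char_pow_def flip: mult.assoc)
qed

lemma sum_cnj_char_pow_mult_t:
  "(\<Sum>z\<in>UNIV - {0}. cnj (char_pow T (s * t) z)) = (if d dvd s then of_nat CARD('a) - 1 else 0)"
proof -
  have "(\<Sum>z\<in>UNIV - {0}. cnj (char_pow T (s * t) z)) = cnj (\<Sum>z\<in>UNIV. char_pow T (s * t) z)"
    unfolding cnj_sum by (rule sum.mono_neutral_left) (auto simp: char_pow_def)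
  thus ?thesis by (simp add: sum_mchar[OF is_mchar_char_pow_T] char_pow_mult_t_eq_triv_iff)
qed

lemma sum_char_pow_mult_power:
  assumes finite_B: "finite B"
  shows "(\<Sum>z\<in>UNIV - {0}. char_pow T (d * j) z *
      (\<Sum>i\<in>B. cnj (char_pow T (i * t + j) z) * gauss (char_pow T (i * t + j))) ^ d)
    = (of_nat CARD('a) - 1) *
      (\<Sum>w | w \<in> tuples d B \<and> d dvd (\<Sum>i<d. w i). \<Prod>i<d. gauss (char_pow T (w i * t + j)))"
proof -
  let ?g = "\<lambda>w. \<Prod>i<d. gauss (char_pow T (w i * t + j))"
  have "char_pow T (d * j) z *
      (\<Sum>i\<in>B. cnj (char_pow T (i * t + j) z) * gauss (char_pow T (i * t + j))) ^ d
      = (\<Sum>w\<in>tuples d B. cnj (char_pow T ((\<Sum>i<d. w i) * t) z) * ?g w)" if "z \<noteq> 0" for z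
    unfolding sum_tuples_prod[OF finite_B, symmetric] sum_distrib_left prod.distrib
      mult.assoc[symmetric] char_pow_mult_prod_cnj[OF that] ..
  hence "(\<Sum>z\<in>UNIV - {0}. char_pow T (d * j) z *
      (\<Sum>i\<in>B. cnj (char_pow T (i * t + j) z) * gauss (char_pow T (i * t + j))) ^ d)
      = (\<Sum>z\<in>UNIV - {0}. \<Sum>w\<in>tuples d B. cnj (char_pow T ((\<Sum>i<d. w i) * t) z) * ?g w)"
    by (intro sum.cong refl) auto
  also have "\<dots> = (\<Sum>w\<in>tuples d B.
      (\<Sum>z\<in>UNIV - {0}. cnj (char_pow T ((\<Sum>i<d. w i) * t) z)) * ?g w)"
    by (subst sum.swap) (simp add: sum_distrib_right)
  also have "\<dots> = (\<Sum>w\<in>tuples d B.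
      if d dvd (\<Sum>i<d. w i) then (of_nat CARD('a) - 1) * ?g w else 0)"
    unfolding sum_cnj_char_pow_mult_t by (intro sum.cong refl) simp
  also have "\<dots> = (\<Sum>w | w \<in> tuples d B \<and> d dvd (\<Sum>i<d. w i). (of_nat CARD('a) - 1) * ?g w)"
    by (rule sum.inter_filter[OF finite_tuples[OF finite_B], symmetric])
  finally show ?thesis by (simp add: sum_distrib_left)
qed

lemma sum_theta_power_moment:
  "(\<Sum>z\<in>UNIV - {0}. (\<Sum>x\<in>UNIV. \<theta> (z * x ^ d)) ^ d)
    = (of_nat CARD('a) - 1) * (\<Sum>w\<in>Wstar d. \<Prod>i<d. gauss (char_pow T (w i * t)))"
proof -
  have "(\<Sum>z\<in>UNIV - {0}. (\<Sum>x\<in>UNIV. \<theta> (z * x ^ d)) ^ d)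
      = (\<Sum>z\<in>UNIV - {0}. char_pow T (d * 0) z *
          (\<Sum>i\<in>{1..<d}. cnj (char_pow T (i * t + 0) z) * gauss (char_pow T (i * t + 0))) ^ d)"
    by (intro sum.cong refl) (simp add: sum_theta_power triv_char_def)
  thus ?thesis unfolding sum_char_pow_mult_power[OF finite_atLeastLessThan] Wstar_eq_tuples
    by simp
qed

lemma sum_monomial_sum_power:
  "(\<Sum>z\<in>UNIV - {0}. char_pow T (d * j) z * monomial_sum (char_pow T (d * j)) z ^ d)
    = (of_nat CARD('a) - 1) * (\<Sum>w\<in>Wset d. \<Prod>i<d. gauss (char_pow T (w i * t + j)))"
proof -
  have "(\<Sum>z\<in>UNIV - {0}. char_pow T (d * j) z * monomial_sum (char_pow T (d * j)) z ^ d)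
      = (\<Sum>z\<in>UNIV - {0}. char_pow T (d * j) z *
          (\<Sum>i<d. cnj (char_pow T (i * t + j) z) * gauss (char_pow T (i * t + j))) ^ d)"
    by (intro sum.cong refl) (simp add: monomial_sum_char_pow)
  thus ?thesis unfolding sum_char_pow_mult_power[OF finite_lessThan] Wset_eq_tuples[OF d_pos] .
qed

lemma theta_dwork_form:
  "\<theta> (dwork_form d lam x * z) = (\<Prod>i<d. \<theta> (z * x i ^ d))
    + of_nat CARD('a) / (of_nat CARD('a) - 1) *
      (\<Sum>m<CARD('a) - 1. char_pow T m (of_nat d * lam) / gauss (char_pow T m) *
        (char_pow T m z * (\<Prod>i<d. char_pow T m (x i) * \<theta> (z * x i ^ d))))"
proof -
  define u where "u = z * (of_nat d * lam) * (\<Prod>i<d. x i)"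
  have "dwork_form d lam x * z = (\<Sum>i<d. z * x i ^ d) + - u"
    by (simp add: dwork_form_def u_def algebra_simps sum_distrib_left)
  hence "\<theta> (dwork_form d lam x * z) = (\<Prod>i<d. \<theta> (z * x i ^ d)) * \<theta> (- u)"
    by (simp only: theta_add theta_sum)
  also have "\<theta> (- u) = 1 + of_nat CARD('a) / (of_nat CARD('a) - 1) *
      (\<Sum>m<CARD('a) - 1. char_pow T m u / gauss (char_pow T m))"
    using theta_expansion[OF generator, of "- u"] by simp
  also have "(\<Sum>m<CARD('a) - 1. char_pow T m u / gauss (char_pow T m))
      = (\<Sum>m<CARD('a) - 1. char_pow T m (of_nat d * lam) / gauss (char_pow T m) *
          (char_pow T m z * (\<Prod>i<d. char_pow T m (x i))))"
    by (intro sum.cong refl)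
       (simp add: u_def mchar_mult[OF is_mchar_char_pow_T] mchar_prod[OF is_mchar_char_pow_T])
  finally show ?thesis by (simp add: prod.distrib sum_distrib_left algebra_simps)
qed

lemma sum_theta_dwork_form:
  "(\<Sum>x\<in>tuples d UNIV. \<theta> (dwork_form d lam x * z)) = (\<Sum>x\<in>UNIV. \<theta> (z * x ^ d)) ^ d
    + of_nat CARD('a) / (of_nat CARD('a) - 1) *
      (\<Sum>m<CARD('a) - 1. char_pow T m (of_nat d * lam) / gauss (char_pow T m) *
        (char_pow T m z * monomial_sum (char_pow T m) z ^ d))"
proof -
  let ?V = "tuples d UNIV :: (nat \<Rightarrow> 'a) set"
  let ?a = "\<lambda>m. char_pow T m (of_nat d * lam) / gauss (char_pow T m)"
  have "(\<Sum>x\<in>?V. \<Sum>m<CARD('a) - 1.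
        ?a m * (char_pow T m z * (\<Prod>i<d. char_pow T m (x i) * \<theta> (z * x i ^ d))))
      = (\<Sum>m<CARD('a) - 1.
        ?a m * (char_pow T m z * (\<Sum>x\<in>?V. \<Prod>i<d. char_pow T m (x i) * \<theta> (z * x i ^ d))))"
    by (subst sum.swap) (simp add: sum_distrib_left)
  thus ?thesis
    unfolding theta_dwork_form sum.distrib sum_distrib_left[symmetric] monomial_sum_def
    by (simp only: sum_tuples_prod[OF finite, of "\<lambda>y. \<theta> (z * y ^ d)"]
        sum_tuples_prod[OF finite, of "\<lambda>y. char_pow T m y * \<theta> (z * y ^ d)" for m])
qed

definition dwork_term :: "'a \<Rightarrow> (nat \<Rightarrow> nat) \<Rightarrow> nat \<Rightarrow> complex" where
  "dwork_term lam w j = (\<Prod>i<d. gauss (char_pow T (w i * t + j))) / gauss (char_pow T (d * j))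
    * char_pow T (d * j) (of_nat d * lam)"

lemma card_dwork_cone_gauss:
  "of_nat CARD('a) * of_nat (card (dwork_cone d lam)) = of_nat CARD('a) ^ d
     + (of_nat CARD('a) - 1) * (\<Sum>w\<in>Wstar d. \<Prod>i<d. gauss (char_pow T (w i * t)))
     + of_nat CARD('a) * (\<Sum>j<t. \<Sum>w\<in>Wset d. dwork_term lam w j)"
proof -
  let ?U = "UNIV - {0 :: 'a}" and ?q = "of_nat CARD('a) :: complex"
  let ?a = "\<lambda>m. char_pow T m (of_nat d * lam) / gauss (char_pow T m)"
  let ?F = "\<lambda>m. ?a m * (\<Sum>z\<in>?U. char_pow T m z * monomial_sum (char_pow T m) z ^ d)"
  have "(\<Sum>z\<in>?U. \<Sum>m<CARD('a) - 1. ?a m * (char_pow T m z * monomial_sum (char_pow T m) z ^ d))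
      = (\<Sum>m<d * t. ?F m)"
    unfolding index by (subst sum.swap) (simp add: sum_distrib_left)
  also have "\<dots> = (\<Sum>j<t. ?F (d * j))"
  proof (rule sum_multiples[OF d_pos])
    show "?F m = 0" if "\<not> d dvd m" for m
      using d_pos by (simp add: monomial_sum_eq_0[OF that] power_0_left)
  qed
  also have "\<dots> = (?q - 1) * (\<Sum>j<t. \<Sum>w\<in>Wset d. dwork_term lam w j)"
    unfolding sum_monomial_sum_power dwork_term_def by (simp add: sum_distrib_left mult_ac)
  finally have "(\<Sum>z\<in>?U. \<Sum>x\<in>tuples d UNIV. \<theta> (dwork_form d lam x * z))
      = (?q - 1) * (\<Sum>w\<in>Wstar d. \<Prod>i<d. gauss (char_pow T (w i * t)))
        + ?q / (?q - 1) * ((?q - 1) * (\<Sum>j<t. \<Sum>w\<in>Wset d. dwork_term lam w j))"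
    unfolding sum_theta_dwork_form sum.distrib sum_distrib_left[symmetric] sum_theta_power_moment
    by simp
  thus ?thesis
    unfolding card_dwork_cone_eq_character_sum
    using of_nat_card_minus_1_nonzero[where 'a='a] by simp
qed

lemma card_dwork_points_gauss:
  "of_nat (card (dwork_points d lam)) = (of_nat CARD('a) ^ (d - 1) - 1) / (of_nat CARD('a) - 1)
     + 1 / of_nat CARD('a) * (\<Sum>w\<in>Wstar d. \<Prod>i<d. gauss (char_pow T (w i * t)))
     + 1 / (of_nat CARD('a) - 1) * (\<Sum>j<t. \<Sum>w\<in>Wset d. dwork_term lam w j)"
proof -
  define q where "q = (of_nat CARD('a) :: complex)"
  define S where "S = (\<Sum>w\<in>Wstar d. \<Prod>i<d. gauss (char_pow T (w i * t)))"
  define R where "R = (\<Sum>j<t. \<Sum>w\<in>Wset d. dwork_term lam w j)"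
  define N where "N = (of_nat (card (dwork_points d lam)) :: complex)"
  have q_nonzero: "q \<noteq> 0" "q - 1 \<noteq> 0"
    using of_nat_card_minus_1_nonzero[where 'a='a] by (auto simp: q_def)
  have "of_nat (card (dwork_cone d lam)) = (q - 1) * N + 1"
    using card_dwork_cone[OF d_pos, of lam] card_field_ge_2[where 'a='a]
    by (simp add: q_def N_def of_nat_diff)
  hence "q * ((q - 1) * N + 1) = q ^ d + (q - 1) * S + q * R"
    using card_dwork_cone_gauss[of lam] by (simp add: q_def S_def R_def)
  moreover have "q ^ d = q * q ^ (d - 1)" using d_pos by (cases d) auto
  ultimately have "N * (q * (q - 1)) = q * (q ^ (d - 1) - 1) + (q - 1) * S + q * R"
    by (simp add: algebra_simps)
  also have "\<dots> = ((q ^ (d - 1) - 1) / (q - 1) + 1 / q * S + 1 / (q - 1) * R) * (q * (q - 1))"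
    using q_nonzero by (simp add: distrib_right)
  finally have "N = (q ^ (d - 1) - 1) / (q - 1) + 1 / q * S + 1 / (q - 1) * R"
    using q_nonzero by simp
  thus ?thesis by (simp only: N_def q_def S_def R_def)
qed

end

section \<open>Greene's hypergeometric function in terms of Gauss sums\<close>

lemma greeneF_triv_lower:
  assumes "d \<ge> 2"
  shows "greeneF (d - 2) (\<lambda>i. A (i + 1)) (\<lambda>i. triv_char) x
    = of_nat CARD('a::{field,finite}) / (of_nat CARD('a) - 1) *
      (\<Sum>\<chi> | is_mchar \<chi>. (\<Prod>i\<in>{1..<d}. char_binom (char_mult (A i) \<chi>) \<chi>) * \<chi> (x :: 'a))"
proof -
  have "char_binom (char_mult (A (0 + 1)) \<chi>) \<chi> *
      (\<Prod>i\<in>{1..d - 2}. char_binom (char_mult (A (i + 1)) \<chi>) (char_mult triv_char \<chi>))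
      = (\<Prod>i\<in>{1..<d}. char_binom (char_mult (A i) \<chi>) \<chi>)"
    if "is_mchar \<chi>" for \<chi> :: "'a \<Rightarrow> complex"
  proof -
    let ?b = "\<lambda>i. char_binom (char_mult (A i) \<chi>) \<chi>"
    have "(\<Prod>i\<in>{1..<d}. ?b i) = ?b 1 * (\<Prod>i\<in>{2..<d}. ?b i)"
      using assms by (simp add: prod.atLeast_Suc_lessThan numeral_2_eq_2)
    also have "(\<Prod>i\<in>{2..<d}. ?b i) = (\<Prod>i\<in>{1..d - 2}. ?b (i + 1))"
      using assms by (intro prod.reindex_bij_witness[of _ "\<lambda>i. i + 1" "\<lambda>i. i - 1"]) auto
    finally show ?thesis by (simp add: char_mult_triv_left[OF that])
  qed
  thus ?thesis unfolding greeneF_def by (intro arg_cong2[of _ _ _ _ "(*)"] sum.cong refl) simp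
qed

lemma (in additive_character) char_binom_gauss:
  assumes mchar_A: "is_mchar A" and mchar_psi: "is_mchar \<psi>" and nontriv: "A \<noteq> triv_char"
  shows "char_binom (char_mult A (char_cnj \<psi>)) (char_cnj \<psi>)
    = \<psi> (-1) * gauss \<psi> / of_nat CARD('a) * (gauss (char_mult (char_cnj \<psi>) A) / gauss A)"
proof -
  have mchar_mult_cnj: "is_mchar (char_mult A (char_cnj \<psi>))"
    using mchar_A mchar_psi by auto
  have "cnj (\<psi> (-1)) = \<psi> (-1)"
    unfolding mchar_cnj[OF mchar_psi]
    by (rule inverse_unique[OF mchar_minus_1_square[OF mchar_psi]])
  moreover have "(\<Sum>x\<in>UNIV. char_mult A (char_cnj \<psi>) x * \<psi> (1 - x))
      = gauss (char_mult A (char_cnj \<psi>)) * gauss \<psi> / gauss A"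
    using nontriv jacobi_sum_eq_gauss[OF mchar_mult_cnj mchar_psi]
    unfolding char_mult_cnj_cancel[OF mchar_A mchar_psi] jacobi_sum_def by blast
  ultimately show ?thesis
    unfolding char_binom_def char_mult_commute[of A] by simp
qed

context residue_gauss_sums
begin

lemma prod_gauss_quotient:
  assumes mchar: "is_mchar \<chi>"
  shows "(\<Prod>i\<in>{1..<d}. gauss (char_mult \<chi> (char_pow T (i * t))) / gauss (char_pow T (i * t)))
    = cnj (\<chi> (of_nat d)) ^ d * gauss (char_pow \<chi> d) / gauss \<chi>"
proof -
  have "char_mult \<chi> triv_char = \<chi>"
    by (simp add: char_mult_commute[of \<chi>] char_mult_triv_left[OF mchar])
  hence "gauss \<chi> * (\<Prod>i\<in>{1..<d}. gauss (char_mult \<chi> (char_pow T (i * t))))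
      = cnj (\<chi> (of_nat d)) ^ d * gauss (char_pow \<chi> d) * (\<Prod>i\<in>{1..<d}. gauss (char_pow T (i * t)))"
    using hasse_davenport_product[OF mchar] by (simp flip: insert_0_range)
  moreover have "(\<Prod>i\<in>{1..<d}. gauss (char_pow T (i * t))) \<noteq> 0"
    by (simp add: gauss_nonzero is_mchar_char_pow_T)
  ultimately show ?thesis
    using gauss_nonzero[OF mchar] by (simp add: prod_dividef field_simps)
qed

lemma prod_char_binom:
  assumes mchar: "is_mchar \<psi>"
  shows "(\<Prod>i\<in>{1..<d}. char_binom (char_mult (char_pow T (i * t)) (char_cnj \<psi>)) (char_cnj \<psi>))
    = (\<psi> (-1) * gauss \<psi> / of_nat CARD('a)) ^ (d - 1) *
      (\<psi> (of_nat d) ^ d * gauss (char_cnj (char_pow \<psi> d)) / gauss (char_cnj \<psi>))"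
proof -
  have "char_pow T (i * t) \<noteq> triv_char" if "i \<in> {1..<d}" for i
    using that by (auto simp: char_pow_mult_t_eq_triv_iff dest: dvd_imp_le)
  hence "(\<Prod>i\<in>{1..<d}. char_binom (char_mult (char_pow T (i * t)) (char_cnj \<psi>)) (char_cnj \<psi>))
      = (\<Prod>i\<in>{1..<d}. \<psi> (-1) * gauss \<psi> / of_nat CARD('a) *
          (gauss (char_mult (char_cnj \<psi>) (char_pow T (i * t))) / gauss (char_pow T (i * t))))"
    by (intro prod.cong refl char_binom_gauss is_mchar_char_pow_T mchar)
  also have "\<dots> = (\<psi> (-1) * gauss \<psi> / of_nat CARD('a)) ^ (d - 1) *
      (\<Prod>i\<in>{1..<d}.
        gauss (char_mult (char_cnj \<psi>) (char_pow T (i * t))) / gauss (char_pow T (i * t)))"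
    unfolding prod.distrib by simp
  finally show ?thesis
    unfolding prod_gauss_quotient[OF is_mchar_char_cnj[OF mchar]] char_pow_cnj by simp
qed

lemma gauss_power_div_gauss_cnj:
  assumes mchar: "is_mchar \<psi>" "\<psi> \<noteq> triv_char"
  shows "(\<psi> (-1) * gauss \<psi>) ^ (d - 1) / gauss (char_cnj \<psi>)
    = char_pow \<psi> d (-1) * gauss \<psi> ^ d / of_nat CARD('a)"
proof -
  define s where "s = \<psi> (-1)"
  obtain e where d_eq: "d = Suc e" using d_pos by (cases d) auto
  have "s * s = 1" unfolding s_def by (rule mchar_minus_1_square[OF mchar(1)])
  hence "inverse s = s" by (rule inverse_unique)
  hence div_s: "x / (s * y) = s * x / y" for x y by (simp add: divide_inverse mult_ac)
  have "(s * gauss \<psi>) ^ e / gauss (char_cnj \<psi>)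
      = (s * gauss \<psi>) ^ e * gauss \<psi> / (s * of_nat CARD('a))"
    using mchar by (simp add: gauss_cnj s_def)
  also have "\<dots> = (s ^ e * s) * gauss \<psi> ^ d / of_nat CARD('a)"
    unfolding div_s by (simp add: d_eq power_mult_distrib mult_ac)
  also have "s ^ e * s = char_pow \<psi> d (-1)" by (simp add: s_def char_pow_def d_eq mult.commute)
  finally show ?thesis by (simp add: s_def d_eq)
qed

text \<open>The correction by \<open>(q - 1) gauss \<psi> ^ d / q\<close> when \<open>\<psi> ^ d\<close> is trivial accounts for the
  constant tuples.\<close>

lemma prod_char_binom_gauss:
  assumes mchar: "is_mchar \<psi>"
  shows "of_nat CARD('a) ^ (d - 1) *
      (\<Prod>i\<in>{1..<d}. char_binom (char_mult (char_pow T (i * t)) (char_cnj \<psi>)) (char_cnj \<psi>))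
    = \<psi> (of_nat d) ^ d * (gauss \<psi> ^ d / gauss (char_pow \<psi> d))
      + (if \<psi> \<noteq> triv_char \<and> char_pow \<psi> d = triv_char
         then (of_nat CARD('a) - 1) / of_nat CARD('a) * gauss \<psi> ^ d else 0)"
proof -
  let ?q = "of_nat CARD('a) :: complex" and ?G = "gauss \<psi>" and ?\<phi> = "char_pow \<psi> d"
  let ?D = "\<psi> (of_nat d) ^ d" and ?v = "char_pow \<psi> d (-1)"
  have "?q ^ (d - 1) * (\<Prod>i\<in>{1..<d}.
      char_binom (char_mult (char_pow T (i * t)) (char_cnj \<psi>)) (char_cnj \<psi>))
      = (\<psi> (-1) * ?G) ^ (d - 1) / gauss (char_cnj \<psi>) * (?D * gauss (char_cnj ?\<phi>))"
    unfolding prod_char_binom[OF mchar] by (simp add: power_divide)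
  also have "\<dots> = ?D * (?G ^ d / gauss ?\<phi>)
      + (if \<psi> \<noteq> triv_char \<and> ?\<phi> = triv_char then (?q - 1) / ?q * ?G ^ d else 0)"
  proof (cases "\<psi> = triv_char")
    case True
    moreover have "triv_char (-1 :: 'a) = 1" "triv_char (of_nat d :: 'a) = 1"
      using of_nat_d_nonzero by (simp_all add: triv_char_def)
    moreover have "(-1 :: complex) ^ d = - ((-1) ^ (d - 1))"
      using d_pos by (simp add: power_eq_if)
    ultimately show ?thesis by (simp add: gauss_triv)
  next
    case False
    have "(\<psi> (-1) * ?G) ^ (d - 1) / gauss (char_cnj \<psi>) * (?D * gauss (char_cnj ?\<phi>))
        = ?v * ?G ^ d / ?q * (?D * (?v * ?q / gauss ?\<phi> + (if ?\<phi> = triv_char then ?q - 1 else 0)))"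
      by (simp only: gauss_power_div_gauss_cnj[OF mchar False]
          gauss_cnj[OF is_mchar_char_pow[OF mchar]])
    also have "\<dots> = ?D * (?G ^ d / gauss ?\<phi>) * (?v * ?v)
        + (if ?\<phi> = triv_char then ?D * ?v * ((?q - 1) / ?q * ?G ^ d) else 0)"
      by (simp add: distrib_left mult_ac)
    also have "?v * ?v = 1" by (rule mchar_minus_1_square[OF is_mchar_char_pow[OF mchar]])
    finally show ?thesis
      using False of_nat_d_nonzero char_pow_def[of \<psi> d "of_nat d"] by (auto simp: triv_char_def)
  qed
  finally show ?thesis .
qed

lemma sum_char_pow_nontriv_power_triv:
  fixes f :: "nat \<Rightarrow> complex"
  shows "(\<Sum>j<CARD('a) - 1. if char_pow T j \<noteq> triv_char \<and> char_pow T (d * j) = triv_char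
      then f j else 0) = (\<Sum>c\<in>{1..<d}. f (c * t))"
proof -
  let ?F = "\<lambda>j. if char_pow T j \<noteq> triv_char \<and> char_pow T (d * j) = triv_char then f j else 0"
  have "(\<Sum>j<CARD('a) - 1. ?F j) = (\<Sum>c<d. ?F (t * c))"
    unfolding index[symmetric] mult.commute[of d t]
    by (rule sum_multiples[OF t_pos]) (simp add: char_pow_d_mult_eq_triv_iff)
  also have "\<dots> = (\<Sum>c\<in>{1..<d}. f (c * t))"
  proof (rule sum.mono_neutral_cong_right)
    show "\<forall>c\<in>{..<d} - {1..<d}. ?F (t * c) = 0" by (auto simp: not_le less_one)
    show "?F (t * c) = f (c * t)" if "c \<in> {1..<d}" for c
      using that
      by (auto simp: mult.commute[of t] char_pow_mult_t_eq_triv_iff dest: dvd_imp_le)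
         (simp add: char_pow_d_mult_eq_triv_iff)
  qed auto
  finally show ?thesis .
qed

lemma prod_char_binom_dwork_term:
  fixes j :: nat
  assumes lam_nonzero: "lam \<noteq> 0"
  defines "\<psi> \<equiv> char_pow T j"
  shows "of_nat CARD('a) ^ (d - 1) *
      ((\<Prod>i\<in>{1..<d}. char_binom (char_mult (char_pow T (i * t)) (char_cnj \<psi>)) (char_cnj \<psi>))
        * cnj (\<psi> (1 / lam ^ d)))
    = dwork_term lam (\<lambda>i. 0) j
      + (if \<psi> \<noteq> triv_char \<and> char_pow T (d * j) = triv_char
         then (of_nat CARD('a) - 1) / of_nat CARD('a) * gauss \<psi> ^ d else 0)"
proof -
  have mchar: "is_mchar \<psi>" unfolding \<psi>_def by (rule is_mchar_char_pow_T)
  have char_pow_eq: "char_pow \<psi> d = char_pow T (d * j)"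
    by (simp add: \<psi>_def mult.commute flip: char_pow_mult)
  have cnj_lam: "cnj (\<psi> (1 / lam ^ d)) = \<psi> lam ^ d"
    by (simp add: inverse_eq_divide[symmetric] mchar_inverse[OF mchar] mchar_power[OF mchar]
        mchar_cnj[OF mchar] power_inverse)
  have "\<psi> lam ^ d = char_pow T (d * j) lam" using lam_nonzero
    by (simp add: char_pow_def flip: char_pow_eq)
  hence lam_triv: "\<psi> lam ^ d = 1" if "char_pow T (d * j) = triv_char"
    using lam_nonzero that by (simp add: triv_char_def)
  have "\<psi> (of_nat d) ^ d * \<psi> lam ^ d = char_pow T (d * j) (of_nat d * lam)"
    using lam_nonzero of_nat_d_nonzero
    by (simp add: char_pow_def mchar_mult[OF mchar] power_mult_distrib flip: char_pow_eq)
  hence "\<psi> (of_nat d) ^ d * (gauss \<psi> ^ d / gauss (char_pow T (d * j))) * \<psi> lam ^ d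
      = dwork_term lam (\<lambda>i. 0) j"
    by (simp add: dwork_term_def \<psi>_def mult_ac)
  thus ?thesis
    unfolding cnj_lam mult.assoc[symmetric] prod_char_binom_gauss[OF mchar] char_pow_eq
      distrib_right
    using lam_triv by auto
qed

lemma greeneF_gauss:
  assumes d_ge_2: "d \<ge> 2" and lam_nonzero: "lam \<noteq> 0"
  shows "of_nat CARD('a) ^ (d - 2) *
      greeneF (d - 2) (\<lambda>i. char_pow T ((i + 1) * t)) (\<lambda>i. triv_char) (1 / lam ^ d)
    = 1 / (of_nat CARD('a) - 1) * (\<Sum>j<CARD('a) - 1. dwork_term lam (\<lambda>i. 0) j)
      + 1 / of_nat CARD('a) * (\<Sum>c\<in>{1..<d}. gauss (char_pow T (c * t)) ^ d)"
proof -
  let ?q = "of_nat CARD('a) :: complex"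
  let ?H = "\<lambda>\<chi>. (\<Prod>i\<in>{1..<d}. char_binom (char_mult (char_pow T (i * t)) \<chi>) \<chi>) * \<chi> (1 / lam ^ d)"
  have "d - 1 = Suc (d - 2)" using d_ge_2 by simp
  hence power_q: "?q ^ (d - 1) = ?q ^ (d - 2) * ?q" by (simp only: power_Suc2)
  have "?q ^ (d - 2) *
      greeneF (d - 2) (\<lambda>i. char_pow T ((i + 1) * t)) (\<lambda>i. triv_char) (1 / lam ^ d)
      = ?q ^ (d - 2) * (?q / (?q - 1) * (\<Sum>j<CARD('a) - 1. ?H (char_cnj (char_pow T j))))"
    unfolding greeneF_triv_lower[OF d_ge_2, of "\<lambda>i. char_pow T (i * t)"]
      sum_mchars_cnj[OF generator] ..
  also have "\<dots> = 1 / (?q - 1) *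
      (\<Sum>j<CARD('a) - 1. ?q ^ (d - 1) * ?H (char_cnj (char_pow T j)))"
    unfolding sum_distrib_left[symmetric] power_q by simp
  also have "\<dots> = 1 / (?q - 1) * ((\<Sum>j<CARD('a) - 1. dwork_term lam (\<lambda>i. 0) j)
      + (?q - 1) / ?q * (\<Sum>c\<in>{1..<d}. gauss (char_pow T (c * t)) ^ d))"
    unfolding prod_char_binom_dwork_term[OF lam_nonzero] sum.distrib
      sum_char_pow_nontriv_power_triv sum_distrib_left ..
  finally show ?thesis
    using of_nat_card_minus_1_nonzero[where 'a='a] by (simp add: distrib_left)
qed

end

section \<open>Classes of exponent tuples\<close>

lemma sum_quotient:
  assumes "equiv A r" "finite A"
  shows "(\<Sum>x\<in>A. f x) = (\<Sum>C\<in>A // r. \<Sum>x\<in>C. f x)"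
proof -
  have "(\<Sum>x\<in>\<Union>(A // r). f x) = (\<Sum>C\<in>A // r. \<Sum>x\<in>C. f x)"
  proof (subst sum.Union_disjoint)
    show "\<forall>C\<in>A // r. finite C"
      using assms in_quotient_imp_subset by (metis finite_subset)
    show "\<forall>C\<in>A // r. \<forall>D\<in>A // r. C \<noteq> D \<longrightarrow> C \<inter> D = {}"
      using quotient_disj[OF assms(1)] by blast
  qed simp
  thus ?thesis by (simp add: Union_quotient[OF assms(1)])
qed

lemma quotient_SOME:
  assumes "equiv A r" "C \<in> A // r"
  shows "(SOME x. x \<in> C) \<in> A" and "r `` {SOME x. x \<in> C} = C"
proof -
  have "(SOME x. x \<in> C) \<in> C"
    using in_quotient_imp_non_empty[OF assms] by (simp add: some_in_eq)
  thus "(SOME x. x \<in> C) \<in> A" using in_quotient_imp_subset[OF assms] by blast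
  obtain y where C_eq: "C = r `` {y}" using assms(2) by (rule quotientE)
  hence "(y, SOME x. x \<in> C) \<in> r" using \<open>(SOME x. x \<in> C) \<in> C\<close> by blast
  thus "r `` {SOME x. x \<in> C} = C"
    using equiv_class_eq[OF assms(1)] C_eq by metis
qed

definition shift_tuple :: "nat \<Rightarrow> nat \<Rightarrow> (nat \<Rightarrow> nat) \<Rightarrow> nat \<Rightarrow> nat" where
  "shift_tuple d k w = (\<lambda>i. if i < d then (w i + k) mod d else 0)"

lemma equiv_Wrel: "equiv (Wset d) (Wrel d)"
proof (rule equivI)
  show "refl_on (Wset d) (Wrel d)"
    by (auto simp: refl_on_def Wrel_def intro!: exI[of _ 0])
  show "sym (Wrel d)"
  proof (rule symI)
    fix w w' assume rel: "(w, w') \<in> Wrel d"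
    then obtain k where diff: "\<forall>i<d. [int (w i) - int (w' i) = k] (mod int d)"
      by (auto simp: Wrel_def)
    have "[int (w' i) - int (w i) = - k] (mod int d)" if "i < d" for i
    proof -
      have "[- (int (w i) - int (w' i)) = - k] (mod int d)"
        using diff that by (simp only: cong_minus_minus_iff)
      thus ?thesis by simp
    qed
    thus "(w', w) \<in> Wrel d" using rel by (auto simp: Wrel_def)
  qed
  show "trans (Wrel d)"
  proof (rule transI)
    fix u v w assume rel_uv: "(u, v) \<in> Wrel d" and rel_vw: "(v, w) \<in> Wrel d"
    obtain k l where diff: "\<forall>i<d. [int (u i) - int (v i) = k] (mod int d)"
      and diff': "\<forall>i<d. [int (v i) - int (w i) = l] (mod int d)" using rel_uv rel_vw
        by (auto simp: Wrel_def)
    have "[int (u i) - int (w i) = k + l] (mod int d)" if "i < d" for i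
      using cong_add[OF diff[rule_format, OF that] diff'[rule_format, OF that]] by simp
    thus "(u, w) \<in> Wrel d" using rel_uv rel_vw by (auto simp: Wrel_def)
  qed
qed (auto simp: Wrel_def)

lemma shift_tuple_in_Wset:
  assumes "d > 0" "w \<in> Wset d"
  shows "shift_tuple d k w \<in> Wset d"
proof -
  have "(\<Sum>i<d. shift_tuple d k w i) mod d = (\<Sum>i<d. w i + k) mod d"
    using mod_sum_eq[of "\<lambda>i. w i + k" d "{..<d}"] by (simp add: shift_tuple_def)
  also have "\<dots> = 0" using assms by (simp add: sum.distrib Wset_def mod_simps)
  finally show ?thesis using assms by (auto simp: Wset_def shift_tuple_def)
qed

lemma Wrel_imp_shift_tuple:
  assumes d_pos: "d > 0" and "(w, v) \<in> Wrel d"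
  shows "\<exists>k<d. v = shift_tuple d k w"
proof -
  obtain k where v_in_Wset: "v \<in> Wset d"
      and diff: "\<And>i. i < d \<Longrightarrow> [int (w i) - int (v i) = k] (mod int d)"
    using assms(2) by (auto simp: Wrel_def)
  define l where "l = nat ((- k) mod int d)"
  have int_l: "int l = (- k) mod int d" using d_pos by (simp add: l_def)
  have "v i = shift_tuple d l w i" for i
  proof (cases "i < d")
    case True
    have "int ((w i + l) mod d) = (int (w i) - k) mod int d"
      by (simp add: zmod_int int_l mod_simps)
    also have "\<dots> = int (v i) mod int d"
      using cong_diff[OF cong_refl[of "int (w i)"] diff[OF True]] by (simp add: cong_def)
    also have "\<dots> = int (v i)" using v_in_Wset True by (simp add: Wset_def)
    finally show ?thesis using True by (simp add: shift_tuple_def)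
  qed (use v_in_Wset in \<open>auto simp: Wset_def shift_tuple_def\<close>)
  moreover have "l < d" using d_pos by (simp add: l_def nat_less_iff)
  ultimately show ?thesis by blast
qed

lemma Wrel_class_eq_shift_tuples:
  assumes d_pos: "d > 0" and w_in_Wset: "w \<in> Wset d"
  shows "Wrel d `` {w} = (\<lambda>k. shift_tuple d k w) ` {..<d}"
proof -
  have "(w, shift_tuple d k w) \<in> Wrel d" for k
  proof -
    have "[int (w i) - int (shift_tuple d k w i) = - int k] (mod int d)" if "i < d" for i
      using that by (simp add: shift_tuple_def zmod_int cong_def mod_simps)
    thus ?thesis using w_in_Wset shift_tuple_in_Wset[OF d_pos w_in_Wset] by (auto simp: Wrel_def)
  qed
  thus ?thesis using Wrel_imp_shift_tuple[OF d_pos] by fastforce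
qed

lemma inj_on_shift_tuple:
  assumes "d > 0"
  shows "inj_on (\<lambda>k. shift_tuple d k w) {..<d}"
proof (rule inj_onI)
  fix k l assume shift_eq: "k \<in> {..<d}" "l \<in> {..<d}" "shift_tuple d k w = shift_tuple d l w"
  have "[w 0 + k = w 0 + l] (mod d)"
    using assms fun_cong[OF shift_eq(3), of 0] by (simp add: shift_tuple_def cong_def)
  hence "[k = l] (mod d)" by (simp only: cong_add_lcancel_nat)
  thus "k = l" using shift_eq by (simp add: cong_def)
qed

lemma sum_Wrel_class:
  fixes f :: "(nat \<Rightarrow> nat) \<Rightarrow> nat \<Rightarrow> 'b::comm_monoid_add"
  assumes d_pos: "d > 0" and w_in_Wset: "w \<in> Wset d"
    and shift: "\<And>k j. f (shift_tuple d k w) j = f w (j + k * t)"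
  shows "(\<Sum>v\<in>Wrel d `` {w}. \<Sum>j<t. f v j) = (\<Sum>j<d * t. f w j)"
proof -
  have "(\<Sum>v\<in>Wrel d `` {w}. \<Sum>j<t. f v j) = (\<Sum>k<d. \<Sum>j<t. f w (j + k * t))"
    unfolding Wrel_class_eq_shift_tuples[OF d_pos w_in_Wset]
      sum.reindex[OF inj_on_shift_tuple[OF d_pos]]
    by (simp add: shift)
  also have "\<dots> = (\<Sum>k<d. \<Sum>j\<in>{k * t..<k * t + t}. f w j)"
    using sum.shift_bounds_nat_ivl[of "f w" 0 "k * t" t for k]
    by (simp add: atLeast0LessThan add.commute)
  also have "\<dots> = (\<Sum>j<d * t. f w j)" by (rule sum.nat_group)
  finally show ?thesis .
qed

lemma sum_Wset_eq_sum_classes: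
  fixes f :: "(nat \<Rightarrow> nat) \<Rightarrow> nat \<Rightarrow> 'b::comm_monoid_add"
  assumes d_pos: "d > 0"
    and shift: "\<And>w k j. w \<in> Wset d \<Longrightarrow> f (shift_tuple d k w) j = f w (j + k * t)"
  shows "(\<Sum>j<t. \<Sum>w\<in>Wset d. f w j) = (\<Sum>j<d * t. f (\<lambda>i. 0) j)
    + (\<Sum>C\<in>Wset d // Wrel d - {Wrel d `` {\<lambda>i. 0}}. \<Sum>j<d * t. f (SOME w. w \<in> C) j)"
proof -
  let ?O = "Wrel d `` {\<lambda>i. 0}"
  have zero_in_Wset: "(\<lambda>i. 0) \<in> Wset d" using d_pos by (simp add: Wset_def)
  have "finite (Wset d // Wrel d)"
    using finite_Wset[OF d_pos] by (rule finite_quotient) (auto simp: Wrel_def)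
  hence "(\<Sum>w\<in>Wset d. \<Sum>j<t. f w j) = (\<Sum>v\<in>?O. \<Sum>j<t. f v j)
      + (\<Sum>C\<in>Wset d // Wrel d - {?O}. \<Sum>w\<in>C. \<Sum>j<t. f w j)"
    unfolding sum_quotient[OF equiv_Wrel finite_Wset[OF d_pos]]
    by (rule sum.remove) (rule quotientI[OF zero_in_Wset])
  also have "(\<Sum>v\<in>?O. \<Sum>j<t. f v j) = (\<Sum>j<d * t. f (\<lambda>i. 0) j)"
    using zero_in_Wset by (intro sum_Wrel_class d_pos shift)
  also have "(\<Sum>C\<in>Wset d // Wrel d - {?O}. \<Sum>w\<in>C. \<Sum>j<t. f w j)
      = (\<Sum>C\<in>Wset d // Wrel d - {?O}. \<Sum>j<d * t. f (SOME w. w \<in> C) j)"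
  proof (rule sum.cong[OF refl])
    fix C assume "C \<in> Wset d // Wrel d - {?O}"
    hence C_class: "C \<in> Wset d // Wrel d" by blast
    show "(\<Sum>w\<in>C. \<Sum>j<t. f w j) = (\<Sum>j<d * t. f (SOME w. w \<in> C) j)"
      using sum_Wrel_class[of d "SOME w. w \<in> C" f t, OF d_pos _ shift]
      by (simp add: quotient_SOME[OF equiv_Wrel C_class])
  qed
  finally show ?thesis by (subst sum.swap)
qed

lemma Wstar_eq_Wss_Un_constant:
  assumes "d \<ge> 2"
  shows "Wstar d = Wss d \<union> (\<lambda>c i. if i < d then c else 0) ` {1..<d}"
proof (intro equalityI subsetI)
  fix w assume w_in_Wstar: "w \<in> Wstar d"
  show "w \<in> Wss d \<union> (\<lambda>c i. if i < d then c else 0) ` {1..<d}"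
  proof (cases "\<forall>i<d. \<forall>j<d. w i = w j")
    case True
    have "w i = (if i < d then w 0 else 0)" for i
    proof (cases "i < d")
      case less: True
      moreover have "0 < d" using assms by simp
      ultimately have "w i = w 0" using True by blast
      thus ?thesis using less by simp
    qed (use w_in_Wstar in \<open>simp add: Wstar_def Wset_def\<close>)
    hence "w = (\<lambda>i. if i < d then w 0 else 0)" by (rule ext)
    moreover have "w 0 \<in> {1..<d}" using w_in_Wstar assms
      by (auto simp: Wstar_def Wset_def Suc_le_eq)
    ultimately show ?thesis by blast
  qed (use w_in_Wstar in \<open>auto simp: Wstar_def Wss_def\<close>)
qed (auto simp: Wstar_def Wss_def Wset_def)

lemma sum_Wstar:
  fixes f :: "nat \<Rightarrow> 'b::comm_semiring_1"
  assumes "d \<ge> 2"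
  shows "(\<Sum>w\<in>Wstar d. \<Prod>i<d. f (w i))
    = (\<Sum>w\<in>Wss d. \<Prod>i<d. f (w i)) + (\<Sum>c\<in>{1..<d}. f c ^ d)"
proof -
  let ?c = "\<lambda>c i. if i < d then c else 0 :: nat"
  have inj_constant: "inj_on ?c {1..<d}"
  proof (rule inj_onI)
    fix a b assume "?c a = ?c b"
    from fun_cong[OF this, of 0] show "a = b" using assms by simp
  qed
  have "(\<Sum>w\<in>Wstar d. \<Prod>i<d. f (w i))
      = (\<Sum>w\<in>Wss d. \<Prod>i<d. f (w i)) + (\<Sum>w\<in>?c ` {1..<d}. \<Prod>i<d. f (w i))"
    unfolding Wstar_eq_Wss_Un_constant[OF assms]
  proof (rule sum.union_disjoint)
    show "finite (Wss d)" using finite_Wset[of d] assms by (simp add: Wss_def)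
  qed (auto simp: Wss_def)
  also have "(\<Sum>w\<in>?c ` {1..<d}. \<Prod>i<d. f (w i)) = (\<Sum>c\<in>{1..<d}. f c ^ d)"
    unfolding sum.reindex[OF inj_constant] by simp
  finally show ?thesis .
qed

section \<open>The point count\<close>

context residue_gauss_sums
begin

lemma dwork_term_shift_tuple:
  "dwork_term lam (shift_tuple d k w) j = dwork_term lam w (j + k * t)"
proof -
  have "char_pow T (d * j) = char_pow T (d * (j + k * t))"
  proof -
    have "d * (j + k * t) = d * j + k * (d * t)" by (simp add: algebra_simps)
    thus ?thesis unfolding char_pow_eq_iff by (simp add: cong_def)
  qed
  moreover have "char_pow T (shift_tuple d k w i * t + j) = char_pow T (w i * t + (j + k * t))"
    if "i < d" for i
  proof -
    have "[(w i + k) mod d * t = (w i + k) * t] (mod (d * t))"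
      by (simp add: cong_def mod_mult_mult2)
    hence "[(w i + k) mod d * t + j = (w i + k) * t + j] (mod (d * t))"
      by (simp add: cong_add_rcancel_nat)
    thus ?thesis using that by (simp add: shift_tuple_def char_pow_eq_iff algebra_simps)
  qed
  ultimately show ?thesis by (simp add: dwork_term_def)
qed

lemma card_dwork_points:
  assumes d_ge_2: "d \<ge> 2" and lam_nonzero: "lam \<noteq> 0"
  shows "of_nat (card (dwork_points d lam)) =
    (of_nat CARD('a) ^ (d - 1) - 1) / (of_nat CARD('a) - 1)
    + of_nat CARD('a) ^ (d - 2) *
        greeneF (d - 2) (\<lambda>i. char_pow T ((i + 1) * t)) (\<lambda>i. triv_char) (1 / lam ^ d)
    + 1 / of_nat CARD('a) * (\<Sum>w\<in>Wss d. \<Prod>i<d. gauss (char_pow T (w i * t)))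
    + 1 / (of_nat CARD('a) - 1) *
        (\<Sum>C\<in>Wset d // Wrel d - {Wrel d `` {\<lambda>i. 0}}.
           \<Sum>j<CARD('a) - 1. dwork_term lam (SOME w. w \<in> C) j)"
  unfolding card_dwork_points_gauss greeneF_gauss[OF d_ge_2 lam_nonzero]
    sum_Wset_eq_sum_classes[where f = "dwork_term lam", OF d_pos dwork_term_shift_tuple]
    sum_Wstar[OF d_ge_2, of "\<lambda>k. gauss (char_pow T (k * t))"] index
  by (simp only: distrib_left add_ac)

end

section \<open>The trace character\<close>

locale prime_power_field =
  fixes p n :: nat and ty :: "'a::{field,finite} itself"
  assumes prime_p: "prime p" and card_eq: "CARD('a) = p ^ n"
begin

lemma CHAR_eq: "CHAR('a) = p"
proof -
  have "prime CHAR('a)"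
    by (intro prime_CHAR_semidom finite_imp_CHAR_pos) simp
  moreover have "CHAR('a) dvd p ^ n" using CHAR_dvd_CARD[where 'a='a] by (simp add: card_eq)
  ultimately show ?thesis using prime_p by (metis prime_dvd_power primes_dvd_imp_eq)
qed

lemma power_p_eq_self_imp_of_nat:
  fixes y :: 'a
  assumes "y ^ p = y"
  shows "\<exists>k. of_nat k = y"
proof -
  have p_gt_1: "p > 1" using prime_p by (rule prime_gt_1_nat)
  define P where "P = monom (1 :: 'a) p - monom 1 1"
  have "coeff P p = 1" using p_gt_1 by (simp add: P_def)
  hence "P \<noteq> 0" by auto
  moreover have "degree P \<le> p"
    unfolding P_def using p_gt_1 by (intro degree_diff_le) (auto simp: degree_monom_eq)
  moreover have "{y. poly P y = 0} = {y. y ^ p = y}" by (auto simp: P_def poly_monom)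
  ultimately have "card {y :: 'a. y ^ p = y} \<le> p" using card_poly_roots_bound[of P] by simp
  moreover have "inj_on (of_nat :: nat \<Rightarrow> 'a) {..<p}"
    by (auto simp: inj_on_def of_nat_eq_iff_cong_CHAR CHAR_eq cong_def)
  moreover have "(of_nat m :: 'a) ^ p = of_nat m" for m
  proof -
    have "(\<Sum>i<m. 1 :: 'a) ^ p = (\<Sum>i<m. 1 ^ p)"
      by (rule freshmans_dream_sum) (simp_all add: CHAR_eq prime_p)
    thus ?thesis by simp
  qed
  ultimately have "of_nat ` {..<p} = {y :: 'a. y ^ p = y}"
    by (intro card_seteq) (auto simp: card_image)
  hence "y \<in> of_nat ` {..<p}" using assms by simp
  thus ?thesis by blast
qed

lemma ftrace_add: "ftrace p n (x + y) = ftrace p n x + ftrace p n (y :: 'a)"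
proof -
  have "(x + y) ^ (p ^ k) = x ^ (p ^ k) + y ^ (p ^ k)" for k
    by (rule freshmans_dream'[of _ k]) (simp_all add: CHAR_eq prime_p)
  thus ?thesis by (simp add: ftrace_def sum.distrib)
qed

lemma ftrace_power_p: "ftrace p n (x :: 'a) ^ p = ftrace p n x"
proof -
  have "ftrace p n x ^ p = (\<Sum>k<n. (x ^ (p ^ k)) ^ p)"
    unfolding ftrace_def by (rule freshmans_dream_sum) (simp_all add: CHAR_eq prime_p)
  also have "\<dots> = (\<Sum>k<n. x ^ (p ^ Suc k))" by (simp add: mult.commute flip: power_mult)
  also have "\<dots> + x ^ (p ^ 0) = (\<Sum>k<Suc n. x ^ (p ^ k))"
    by (simp add: sum.lessThan_Suc_shift del: sum.lessThan_Suc)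
  hence "(\<Sum>k<n. x ^ (p ^ Suc k)) = ftrace p n x"
    using field_power_card[of x] by (simp add: ftrace_def card_eq)
  finally show ?thesis .
qed

lemma ex_of_nat_eq_ftrace: "\<exists>k. of_nat k = ftrace p n (x :: 'a)"
  by (rule power_p_eq_self_imp_of_nat[OF ftrace_power_p])

lemma ftrace_nonzero: "\<exists>x :: 'a. ftrace p n x \<noteq> 0"
proof (rule ccontr)
  assume "\<not> ?thesis"
  hence trace_0: "ftrace p n x = 0" for x :: 'a by blast
  have p_gt_1: "p > 1" using prime_p by (rule prime_gt_1_nat)
  have n_pos: "n > 0" using card_field_ge_2[where 'a='a] card_eq by (intro gr0I) simp
  define P where "P = (\<Sum>k<n. monom (1 :: 'a) (p ^ k))"
  have "degree P \<le> p ^ (n - 1)"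
    unfolding P_def using p_gt_1
    by (intro degree_sum_le) (auto simp: degree_monom_eq intro!: power_increasing)
  also have "\<dots> < p ^ n" using p_gt_1 n_pos by (intro power_strict_increasing) auto
  finally have "degree P < CARD('a)" by (simp add: card_eq)
  hence "P = 0"
    using trace_0
    by (intro poly_eqI_degree[of UNIV]) (auto simp: P_def poly_sum poly_monom ftrace_def)
  moreover have "coeff P (p ^ 0) = (\<Sum>k<n. if k = 0 then 1 else 0)"
    unfolding P_def coeff_sum using p_gt_1 by (intro sum.cong refl) (auto simp: coeff_monom)
  ultimately show False using n_pos by simp
qed

context
  fixes \<zeta> :: complex
  assumes root: "\<zeta> ^ p = 1" "\<zeta> \<noteq> 1"
begin

lemma add_char_eq_power:
  assumes trace_eq: "of_nat k = ftrace p n (x :: 'a)"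
  shows "add_char p n \<zeta> x = \<zeta> ^ k"
proof -
  have "(THE m. m < p \<and> of_nat m = ftrace p n x) = k mod p"
    using prime_gt_0_nat[OF prime_p]
    by (intro the_equality)
       (auto simp: trace_eq[symmetric] of_nat_eq_iff_cong_CHAR CHAR_eq cong_def)
  thus ?thesis
    using power_cong_exponent[OF root(1), of "k mod p" k] by (simp add: add_char_def cong_def)
qed

lemma add_char_nontrivial: "\<exists>x :: 'a. add_char p n \<zeta> x \<noteq> 1"
proof -
  obtain x :: 'a where "ftrace p n x \<noteq> 0" using ftrace_nonzero by blast
  moreover obtain k where trace_eq: "of_nat k = ftrace p n x" using ex_of_nat_eq_ftrace by blast
  ultimately have "\<not> p dvd k" by (metis CHAR_eq of_nat_eq_0_iff_char_dvd)
  hence "coprime k p" using prime_p by (metis coprime_commute prime_imp_coprime)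
  then obtain u where "[k * u = 1] (mod p)"
    using cong_solve_coprime_nat by (metis One_nat_def)
  hence "\<zeta> ^ (k * u) = \<zeta> ^ 1" by (rule power_cong_exponent[OF root(1)])
  hence "\<zeta> ^ k \<noteq> 1" using root(2) by (auto simp: power_mult)
  thus ?thesis using add_char_eq_power[OF trace_eq] by metis
qed

lemma additive_character_add_char: "additive_character (add_char p n \<zeta> :: 'a \<Rightarrow> complex)"
proof
  fix x y :: 'a
  obtain k l where trace_eq: "of_nat k = ftrace p n x" "of_nat l = ftrace p n y"
    using ex_of_nat_eq_ftrace by metis
  have "add_char p n \<zeta> (x + y) = \<zeta> ^ (k + l)"
    by (rule add_char_eq_power) (simp add: trace_eq ftrace_add)
  thus "add_char p n \<zeta> (x + y) = add_char p n \<zeta> x * add_char p n \<zeta> y"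
    by (simp add: add_char_eq_power[OF trace_eq(1)] add_char_eq_power[OF trace_eq(2)] power_add)
next
  have "of_nat 0 = ftrace p n (0 :: 'a)"
    using prime_gt_0_nat[OF prime_p] by (simp add: ftrace_def power_0_left)
  thus "add_char p n \<zeta> (0 :: 'a) = 1" using add_char_eq_power[of 0 0] by simp
qed (rule add_char_nontrivial)

end

end

theorem theorem8p1:
  fixes T :: "'a::{field,finite} \<Rightarrow> complex"
    and lam :: 'a and d p n :: nat and \<zeta> :: complex
  assumes "d \<ge> 2"
    and "prime p" and "n \<ge> 1" and "CARD('a) = p ^ n"
    and "CARD('a) mod d = 1"
    and "\<zeta> ^ p = 1" and "\<zeta> \<noteq> 1"
    and "char_generator T"
    and "lam \<noteq> 0"
  shows
   "(let q = CARD('a); t = (q - 1) div d; g = gauss_sum p n \<zeta> in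
     of_nat (card (dwork_points d lam)) =
       (of_nat q ^ (d - 1) - 1) / (of_nat q - 1)
     + of_nat q ^ (d - 2) *
         greeneF (d - 2) (\<lambda>i. char_pow T ((i + 1) * t)) (\<lambda>i. triv_char) (1 / lam ^ d)
     + 1 / of_nat q * (\<Sum>w\<in>Wss d. \<Prod>i<d. g (char_pow T (w i * t)))
     + 1 / (of_nat q - 1) *
         (\<Sum>C\<in>(Wset d // Wrel d) - {Wrel d `` {(\<lambda>i. 0)}}.
            let w = (SOME w. w \<in> C) in
            \<Sum>j\<in>{0..q - 2}.
              (\<Prod>i<d. g (char_pow T (w i * t + j))) / g (char_pow T (d * j))
                * char_pow T (d * j) (of_nat d * lam)))"
proof -
  define t where "t = (CARD('a) - 1) div d"
  have "d dvd CARD('a) - 1" using assms(5) by (metis dvd_minus_mod)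
  hence index: "d * t = CARD('a) - 1" by (simp add: t_def)
  interpret prime_power_field p n "TYPE('a)"
    using assms(2,4) by unfold_locales
  interpret additive_character "add_char p n \<zeta> :: 'a \<Rightarrow> complex"
    using assms(6,7) by (rule additive_character_add_char)
  interpret residue_gauss_sums "add_char p n \<zeta>" T d t
    using assms(8) index by unfold_locales
  have "gauss_sum p n \<zeta> = gauss"
    by (simp add: fun_eq_iff gauss_sum_def gauss_def)
  moreover have "{0..CARD('a) - 2} = {..<CARD('a) - 1}"
    using card_field_ge_2[where 'a='a] by auto
  ultimately show ?thesis
    using card_dwork_points[OF assms(1,9)]
    by (simp only: Let_def t_def[symmetric] dwork_term_def)
qed

end
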